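(* Let $\Omega$ be a finite alphabet with $b\ge 2$ symbols. Then there are countably (infinitely) many computable Poisson generic elements in $\Omega^{\mathbb N}$; that is, the set of all $x\in\Omega^{\mathbb N}$ that are both computable and Poisson generic is countably infinite.
   Context: $\mathbb N=\{1,2,\dots\}$ and $\mathbb N_0=\{0,1,2,\dots\}$. $\Omega^k$ is the set of words of length $k$ over $\Omega$ and $\Omega^{\mathbb N}$ is the set of infinite sequences of symbols of $\Omega$. Positions in words and sequences are numbered starting from $1$; $x[j,j+k)$ denotes the block of $x$ occupying positions $j,j+1,\dots,j+k-1$. For $j,k\in\mathbb N$, $x\in\Omega^{\mathbb N}$ and $\omega\in\Omega^k$, let $I_j(x,\omega)=1$ if $x[j,j+k)=\omega$ and $I_j(x,\omega)=0$ otherwise. For a positive real $\lambda$, $k\in\mathbb N$ and $i\in\mathbb N_0$ let $$Z^\lambda_{i,k}(x)=\frac{1}{b^k}\,\#\Big\{\omega\in\Omega^k:\ \sum_{1\le j\le \lambda b^k} I_j(x,\omega)=i\Big\}.$$ An element $x\in\Omega^{\mathbb N}$ is $\lambda$-Poisson generic if for every $i\in\mathbb N_0$, $\lim_{k\to\infty}Z^\lambda_{i,k}(x)=e^{-\lambda}\lambda^i/i!$. It is Poisson generic if it is $\lambda$-Poisson generic for all positive real numbers $\lambda$. An element $x\in\Omega^{\mathbb N}$ is computable if there is a computable function $f:\mathbb N\to\Omega$ such that $f(n)$ is the $n$-th symbol of $x$ for every $n$. *)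

theory Defs
  imports Complex_Main "HOL-Library.FuncSet" "HOL-Library.Countable_Set"
begin

section \<open>Computable functions\<close>

text \<open>Codes for the Kleene partial recursive functions. Arities are not recorded: the length of the
  argument list fixes the arity of every subterm.\<close>

datatype recf =
    Zero
  | Succ
  | Proj nat
  | Comp recf "recf list"
  | PrimRec recf recf
  | Mu recf

text \<open>\<open>rec_eval f xs y\<close> means that \<open>f\<close> halts on the arguments \<open>xs\<close> with value \<open>y\<close>. Recursion and
  minimization act on the first argument.\<close>

inductive rec_eval :: "recf \<Rightarrow> nat list \<Rightarrow> nat \<Rightarrow> bool" where
  zero: "rec_eval Zero xs 0"
| succ: "rec_eval Succ [x] (Suc x)"
| proj: "i < length xs \<Longrightarrow> rec_eval (Proj i) xs (xs ! i)"
| comp: "list_all2 (\<lambda>g y. rec_eval g xs y) gs ys \<Longrightarrow> rec_eval f ys z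
    \<Longrightarrow> rec_eval (Comp f gs) xs z"
| primrec_0: "rec_eval f xs y \<Longrightarrow> rec_eval (PrimRec f g) (0 # xs) y"
| primrec_Suc: "rec_eval (PrimRec f g) (n # xs) y \<Longrightarrow> rec_eval g (n # y # xs) z
    \<Longrightarrow> rec_eval (PrimRec f g) (Suc n # xs) z"
| mu: "rec_eval f (n # xs) 0 \<Longrightarrow> (\<forall>m<n. \<exists>y>0. rec_eval f (m # xs) y)
    \<Longrightarrow> rec_eval (Mu f) xs n"

inductive_cases rec_eval_elims:
  "rec_eval Zero xs z"
  "rec_eval Succ xs z"
  "rec_eval (Proj i) xs z"
  "rec_eval (Comp f gs) xs z"
  "rec_eval (PrimRec f g) (0 # xs) z"
  "rec_eval (PrimRec f g) (Suc n # xs) z"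
  "rec_eval (Mu f) xs z"

lemma rec_eval_unique: "rec_eval f xs y \<Longrightarrow> rec_eval f xs z \<Longrightarrow> y = z"
proof (induction arbitrary: z rule: rec_eval.induct)
  case (zero xs)
  then show ?case by (rule rec_eval_elims(1)) simp
next
  case (succ x)
  then show ?case by (rule rec_eval_elims(2)) simp
next
  case (proj i xs)
  from proj.prems show ?case by (rule rec_eval_elims(3)) simp
next
  case (comp xs gs ys f z')
  from comp.prems obtain ys' where
    ys': "list_all2 (\<lambda>g y. rec_eval g xs y) gs ys'" "rec_eval f ys' z"
    by (rule rec_eval_elims(4))
  have "ys = ys'"
    using comp.IH(1) ys'(1) by (auto simp: list_all2_conv_all_nth intro!: nth_equalityI)
  then show ?case using comp.IH(2) ys'(2) by simp
next
  case (primrec_0 f xs y g)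
  from primrec_0.prems show ?case
    by (rule rec_eval_elims(5)) (rule primrec_0.IH)
next
  case (primrec_Suc f g n xs y z')
  from primrec_Suc.prems obtain y' where "rec_eval (PrimRec f g) (n # xs) y'"
    and z: "rec_eval g (n # y' # xs) z"
    by (rule rec_eval_elims(6))
  then have "y = y'" using primrec_Suc.IH(1) by blast
  then show ?case using primrec_Suc.IH(2) z by blast
next
  case (mu f n xs)
  from mu.prems have z: "rec_eval f (z # xs) 0" "\<forall>m<z. \<exists>y>0. rec_eval f (m # xs) y"
    by (blast elim: rec_eval_elims(7))+
  have "\<not> n < z" using z(2) mu.IH(1) by blast
  moreover have "\<not> z < n" using z(1) mu.IH(2) by blast
  ultimately show ?case by simp
qed

text \<open>Here the domain of \<open>f\<close> is \<open>{1, 2, \<dots>}\<close>. The symbols of the finite alphabet are coded by the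
  numbers below its size; the notion does not depend on the chosen coding \<open>c\<close>, because any
  permutation of a finite set of numbers is recursive.\<close>

definition computable_map :: "'a set \<Rightarrow> (nat \<Rightarrow> 'a) \<Rightarrow> bool" where
  "computable_map \<Omega> f \<longleftrightarrow> f \<in> {1..} \<rightarrow> \<Omega> \<and>
     (\<exists>c p. bij_betw c \<Omega> {..<card \<Omega>} \<and> (\<forall>n\<ge>1. rec_eval p [n] (c (f n))))"


section \<open>Words and sequences\<close>

definition words :: "'a set \<Rightarrow> nat \<Rightarrow> 'a list set" where
  "words \<Omega> k = {w. set w \<subseteq> \<Omega> \<and> length w = k}"

text \<open>Positions start at 1. The extensional function space fixes the irrelevant value at 0, so that
  each sequence is represented by exactly one function.\<close>

definition seqs :: "'a set \<Rightarrow> (nat \<Rightarrow> 'a) set" where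
  "seqs \<Omega> = {1..} \<rightarrow>\<^sub>E \<Omega>"

definition block :: "(nat \<Rightarrow> 'a) \<Rightarrow> nat \<Rightarrow> nat \<Rightarrow> 'a list" where
  "block x j k = map x [j..<j + k]"

definition computable_seq :: "'a set \<Rightarrow> (nat \<Rightarrow> 'a) \<Rightarrow> bool" where
  "computable_seq \<Omega> x \<longleftrightarrow> (\<exists>f. computable_map \<Omega> f \<and> (\<forall>n\<ge>1. f n = x n))"


section \<open>Poisson genericity\<close>

definition occ :: "(nat \<Rightarrow> 'a) \<Rightarrow> 'a list \<Rightarrow> nat \<Rightarrow> nat" where
  "occ x w j = (if block x j (length w) = w then 1 else 0)"

definition Z :: "'a set \<Rightarrow> real \<Rightarrow> nat \<Rightarrow> nat \<Rightarrow> (nat \<Rightarrow> 'a) \<Rightarrow> real" where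
  "Z \<Omega> lam i k x =
     1 / real (card \<Omega> ^ k) *
     real (card {w \<in> words \<Omega> k.
       (\<Sum>j | 1 \<le> j \<and> real j \<le> lam * real (card \<Omega> ^ k). occ x w j) = i})"

definition poisson_generic_at :: "'a set \<Rightarrow> real \<Rightarrow> (nat \<Rightarrow> 'a) \<Rightarrow> bool" where
  "poisson_generic_at \<Omega> lam x \<longleftrightarrow>
     (\<forall>i. (\<lambda>k. Z \<Omega> lam i k x) \<longlonglongrightarrow> exp (- lam) * lam ^ i / fact i)"

definition poisson_generic :: "'a set \<Rightarrow> (nat \<Rightarrow> 'a) \<Rightarrow> bool" where
  "poisson_generic \<Omega> x \<longleftrightarrow> (\<forall>lam>0. poisson_generic_at \<Omega> lam x)"

end

theory Submission
  imports Defs "HOL-Real_Asymp.Real_Asymp" "HOL-Analysis.Analysis"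
begin

text \<open>
  Code the symbols by the digits below \<open>b\<close>. Write \<open>freq k T i x\<close> for the proportion of the
  words of length \<open>k\<close> that occur exactly \<open>i\<close> times among the first \<open>T\<close> blocks of \<open>x\<close>. The proof
  shows that a random sequence is Poisson generic with room to spare, and then removes the
  randomness by the method of conditional expectations, which is an algorithm.

  The mean \<open>mean k T i\<close> of the frequency over random sequences obeys, up to an error of order
  \<open>k p\<^sup>2\<close> with \<open>p = 1 / b ^ k\<close>, the recursion in \<open>T\<close> of the binomial distribution (\<open>mean_Suc\<close>):
  the next block equals a given word with probability \<open>p\<close>, independently of all blocks that it
  does not overlap, and the blocks at two different positions are equal with probability exactly \<open>p\<close>, even if
  they overlap. As \<open>T\<close> is of order \<open>b ^ k\<close>, the accumulated error vanishes, and the binomial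
  probabilities converge to the Poisson probabilities (\<open>mean_tendsto_Poisson\<close>).

  Changing one symbol of \<open>x\<close> changes at most \<open>k\<close> blocks and hence changes the frequency by at most
  \<open>2 k / b ^ k\<close>. Since about \<open>k b ^ k\<close> symbols matter, the variance is of order \<open>k ^ 3 / b ^ k\<close>, and
  this holds also conditionally on any prefix of length about \<open>k\<close> (\<open>ave_square\<close>, \<open>ave_bias\<close>).
  Let \<open>dev k x\<close> be the sum of the squared deviations of the frequencies from their means over
  \<open>i \<le> k\<close> and over a grid of values of \<open>T\<close> which becomes dense in the scale \<open>b ^ k\<close>. Its
  conditional expectation after \<open>k + 1\<close> arbitrary symbols is at most \<open>entry k\<close>, and these bounds
  are summable.

  Now choose the symbols one after the other. At step \<open>n\<close> take a symbol that does not increase the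
  conditional expectation of the sum of \<open>dev k\<close> over \<open>k < n\<close>; the term \<open>dev n\<close> joins the sum
  afterwards, at a cost of at most \<open>entry n\<close>. So the sum of all \<open>dev k x\<close> is finite
  (\<open>greedy_cost_bounded\<close>), \<open>dev k x\<close> tends to \<open>0\<close>, and \<open>x\<close> is Poisson generic for every real
  parameter (\<open>greedy_imp_poisson\<close>).

  Each step compares finitely many rational numbers with a common denominator, that is, values of
  a function built from sums and arithmetic on natural numbers. Hence the sequence is recursive
  (\<open>recursive_greedy\<close>). Altering a single symbol preserves both properties, which gives infinitely
  many such sequences, and there are only countably many programs.
\<close>

section \<open>Closure properties of the recursive functions\<close>

text \<open>The arity is the length of the argument list. Arguments in front of a list are read off with
  \<open>hd\<close> and \<open>tl\<close> below, so that a rule for a binder can present the bound variable as the head of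
  the extended argument list and the body of the binder remains a higher-order pattern.\<close>

definition recursive :: "nat \<Rightarrow> (nat list \<Rightarrow> nat) \<Rightarrow> bool" where
  "recursive n f \<longleftrightarrow> (\<exists>p. \<forall>xs. length xs = n \<longrightarrow> rec_eval p xs (f xs))"

lemma recursive_proj: "i < n \<Longrightarrow> recursive n (\<lambda>xs. xs ! i)"
  unfolding recursive_def using rec_eval.proj by blast

lemma recursive_subst:
  assumes f: "recursive (length gs) f" and gs: "\<forall>g\<in>set gs. recursive n g"
  shows "recursive n (\<lambda>xs. f (map (\<lambda>g. g xs) gs))"
proof -
  obtain p where p: "\<And>xs. length xs = length gs \<Longrightarrow> rec_eval p xs (f xs)"
    using f unfolding recursive_def by blast
  obtain q where q: "\<And>g xs. g \<in> set gs \<Longrightarrow> length xs = n \<Longrightarrow> rec_eval (q g) xs (g xs)"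
    using gs unfolding recursive_def by metis
  have "rec_eval (Comp p (map q gs)) xs (f (map (\<lambda>g. g xs) gs))" if "length xs = n" for xs
    by (rule rec_eval.comp[where ys = "map (\<lambda>g. g xs) gs"])
      (use that q p in \<open>auto simp: list_all2_conv_all_nth\<close>)
  then show ?thesis unfolding recursive_def by blast
qed

lemma recursive_cong:
  assumes "recursive n f" and "\<And>xs. length xs = n \<Longrightarrow> f xs = g xs"
  shows "recursive n g"
  using assms unfolding recursive_def by metis

lemma recursive_zero: "recursive n (\<lambda>xs. 0)"
  unfolding recursive_def using rec_eval.zero by blast

lemma recursive_Suc: "recursive n f \<Longrightarrow> recursive n (\<lambda>xs. Suc (f xs))"
proof -
  have "recursive 1 (\<lambda>xs. Suc (hd xs))"
    unfolding recursive_def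
    by (rule exI[of _ Succ]) (auto simp: length_Suc_conv intro: rec_eval.succ)
  then show "recursive n f \<Longrightarrow> recursive n (\<lambda>xs. Suc (f xs))"
    using recursive_subst[of "[f]" "\<lambda>xs. Suc (hd xs)" n] by simp
qed

lemma recursive_const: "recursive n (\<lambda>xs. c)"
  by (induction c) (auto intro: recursive_zero recursive_Suc)

lemma recursive_hd: "0 < n \<Longrightarrow> recursive n hd"
  by (rule recursive_cong[OF recursive_proj[of 0]]) (auto simp: hd_conv_nth)

lemma recursive_tl:
  assumes "recursive n f"
  shows "recursive (Suc n) (\<lambda>xs. f (tl xs))"
proof -
  let ?gs = "map (\<lambda>i xs. xs ! Suc i) [0..<n]"
  have "recursive (Suc n) (\<lambda>xs. f (map (\<lambda>g. g xs) ?gs))"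
    using assms by (intro recursive_subst) (auto intro!: recursive_proj)
  moreover have "f (map (\<lambda>g. g xs) ?gs) = f (tl xs)" if "length xs = Suc n" for xs
    using that by (intro arg_cong[of _ _ f] nth_equalityI) (auto simp: nth_tl)
  ultimately show ?thesis by (rule recursive_cong)
qed

lemma recursive_rec:
  assumes f: "recursive n f"
    and g: "recursive (Suc (Suc n)) (\<lambda>ys. g (hd ys) (hd (tl ys)) (tl (tl ys)))"
    and e: "recursive n e"
  shows "recursive n (\<lambda>xs. rec_nat (f xs) (\<lambda>m y. g m y xs) (e xs))"
proof -
  obtain p where p: "\<And>xs. length xs = n \<Longrightarrow> rec_eval p xs (f xs)"
    using f unfolding recursive_def by blast
  obtain q where q: "\<And>ys. length ys = Suc (Suc n) \<Longrightarrow>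
      rec_eval q ys (g (hd ys) (hd (tl ys)) (tl (tl ys)))"
    using g unfolding recursive_def by blast
  have rec: "rec_eval (PrimRec p q) (m # xs) (rec_nat (f xs) (\<lambda>m y. g m y xs) m)"
    if "length xs = n" for m xs
  proof (induction m)
    case 0
    then show ?case using p[OF that] by (auto intro: rec_eval.primrec_0)
  next
    case (Suc m)
    then show ?case
      using q[of "m # rec_nat (f xs) (\<lambda>m y. g m y xs) m # xs"] that
      by (auto intro: rec_eval.primrec_Suc)
  qed
  have "recursive (Suc n) (\<lambda>zs. rec_nat (f (tl zs)) (\<lambda>m y. g m y (tl zs)) (hd zs))"
    unfolding recursive_def using rec by (auto simp: length_Suc_conv intro!: exI[of _ "PrimRec p q"])
  then have "recursive n (\<lambda>xs. (\<lambda>zs. rec_nat (f (tl zs)) (\<lambda>m y. g m y (tl zs)) (hd zs))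
      (map (\<lambda>h. h xs) (e # map (\<lambda>i xs. xs ! i) [0..<n])))"
    using e by (intro recursive_subst) (auto intro!: recursive_proj)
  moreover have "map (\<lambda>h. h xs) (map (\<lambda>i xs. xs ! i) [0..<n]) = xs" if "length xs = n" for xs :: "nat list"
    using that by (auto intro: nth_equalityI)
  ultimately show ?thesis by (elim recursive_cong) (simp add: comp_def)
qed

lemma recursive_hd_tl:
  "recursive (Suc n) (\<lambda>xs. hd xs)"
  "recursive (Suc (Suc n)) (\<lambda>xs. hd (tl xs))"
  "recursive (Suc (Suc (Suc n))) (\<lambda>xs. hd (tl (tl xs)))"
  by (auto intro!: recursive_tl recursive_hd)

lemma recursive_nth_tl:
  "i < n \<Longrightarrow> recursive n (\<lambda>xs. xs ! i)"
  "i < n \<Longrightarrow> recursive (Suc n) (\<lambda>xs. tl xs ! i)"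
  "i < n \<Longrightarrow> recursive (Suc (Suc n)) (\<lambda>xs. tl (tl xs) ! i)"
  "i < n \<Longrightarrow> recursive (Suc (Suc (Suc n))) (\<lambda>xs. tl (tl (tl xs)) ! i)"
  by (auto intro: recursive_tl[of _ "\<lambda>xs. xs ! i"] recursive_tl[of _ "\<lambda>xs. tl xs ! i"]
     recursive_tl[of _ "\<lambda>xs. tl (tl xs) ! i"] recursive_proj)

lemma recursive_tl2: "recursive n f \<Longrightarrow> recursive (Suc (Suc n)) (\<lambda>xs. f (tl (tl xs)))"
  by (rule recursive_tl[of _ "\<lambda>xs. f (tl xs)"]) (rule recursive_tl)

lemma recursive_add:
  assumes "recursive n f" "recursive n g"
  shows "recursive n (\<lambda>xs. f xs + g xs)"
proof -
  have "recursive n (\<lambda>xs. rec_nat (f xs) (\<lambda>m y. Suc y) (g xs))"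
    using assms by (intro recursive_rec recursive_Suc recursive_hd_tl)
  moreover have "rec_nat a (\<lambda>m y. Suc y) c = a + c" for a c :: nat
    by (induction c) auto
  ultimately show ?thesis by simp
qed

lemma recursive_sum:
  assumes "recursive n e" "recursive (Suc n) (\<lambda>ys. f (hd ys) (tl ys))"
  shows "recursive n (\<lambda>xs. \<Sum>j<e xs. f j xs)"
proof -
  have "recursive (Suc (Suc n)) (\<lambda>zs. (\<lambda>ys. f (hd ys) (tl ys))
      (map (\<lambda>h. h zs) (hd # map (\<lambda>i zs. zs ! (Suc (Suc i))) [0..<n])))"
    using assms(2) by (intro recursive_subst) (auto intro!: recursive_proj recursive_hd_tl)
  moreover have "map (\<lambda>h. h zs) (map (\<lambda>i zs. zs ! (Suc (Suc i))) [0..<n]) = tl (tl zs)"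
    if "length zs = Suc (Suc n)" for zs :: "nat list"
    using that by (auto intro!: nth_equalityI simp: nth_tl)
  ultimately have "recursive (Suc (Suc n)) (\<lambda>zs. f (hd zs) (tl (tl zs)))"
    by (elim recursive_cong) (simp add: comp_def)
  then have "recursive n (\<lambda>xs. rec_nat 0 (\<lambda>m y. y + f m xs) (e xs))"
    using assms by (intro recursive_rec recursive_add recursive_const recursive_hd_tl)
  moreover have "rec_nat 0 (\<lambda>m y. y + f m xs) c = (\<Sum>j<c. f j xs)" for c xs
    by (induction c) auto
  ultimately show ?thesis by simp
qed

lemma recursive_mult:
  assumes "recursive n f" "recursive n g"
  shows "recursive n (\<lambda>xs. f xs * g xs)"
proof -
  have "recursive n (\<lambda>xs. \<Sum>j<g xs. f xs)"
    using assms by (intro recursive_sum recursive_tl)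
  then show ?thesis by (simp add: mult.commute)
qed

lemma recursive_power:
  assumes "recursive n f" "recursive n g"
  shows "recursive n (\<lambda>xs. f xs ^ g xs)"
proof -
  have "recursive n (\<lambda>xs. rec_nat 1 (\<lambda>m y. f xs * y) (g xs))"
    using assms by (intro recursive_rec recursive_mult recursive_tl2 recursive_hd_tl recursive_const)
  moreover have "rec_nat 1 (\<lambda>m y. a * y) c = a ^ c" for a c :: nat
    by (induction c) auto
  ultimately show ?thesis by simp
qed

lemma recursive_diff:
  assumes "recursive n f" "recursive n g"
  shows "recursive n (\<lambda>xs. f xs - g xs)"
proof -
  have pred: "recursive (Suc (Suc n)) (\<lambda>ys. rec_nat 0 (\<lambda>m y. m) (hd (tl ys)))"
    by (rule recursive_rec) (rule recursive_const recursive_hd_tl)+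
  have "recursive n (\<lambda>xs. rec_nat (f xs) (\<lambda>m y. rec_nat 0 (\<lambda>m y. m) y) (g xs))"
    by (rule recursive_rec[OF assms(1) pred assms(2)])
  moreover have "rec_nat a (\<lambda>m y. rec_nat 0 (\<lambda>m y. m) y) c = a - c" for a c :: nat
  proof (induction c)
    case (Suc c)
    have "rec_nat 0 (\<lambda>m y. m) y = y - 1" for y :: nat by (cases y) auto
    then show ?case using Suc by simp
  qed simp
  ultimately show ?thesis by simp
qed

lemma recursive_le:
  assumes "recursive n f" "recursive n g"
  shows "recursive n (\<lambda>xs. of_bool (f xs \<le> g xs))"
proof -
  have "recursive n (\<lambda>xs. 1 - (f xs - g xs))"
    using assms by (intro recursive_diff recursive_const)
  then show ?thesis by (rule recursive_cong) auto
qed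

lemma recursive_eq:
  assumes "recursive n f" "recursive n g"
  shows "recursive n (\<lambda>xs. of_bool (f xs = g xs))"
proof -
  have "recursive n (\<lambda>xs. of_bool (f xs \<le> g xs) * of_bool (g xs \<le> f xs))"
    using assms by (intro recursive_mult recursive_le)
  then show ?thesis by (rule recursive_cong) auto
qed

text \<open>The quotient counts the positive multiples of the divisor up to the dividend. The factor in
  front of the sum makes the value \<open>0\<close> when the divisor is \<open>0\<close>.\<close>

lemma recursive_div:
  assumes "recursive n f" "recursive n g"
  shows "recursive n (\<lambda>xs. f xs div g xs)"
proof -
  have "recursive n (\<lambda>xs. (1 - of_bool (g xs = 0)) *
      (\<Sum>q<f xs. of_bool (Suc q * g xs \<le> f xs)))"
    using assms
    by (intro recursive_sum recursive_tl recursive_le recursive_mult recursive_const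
        recursive_diff recursive_eq recursive_Suc recursive_hd_tl)
  moreover have "(\<Sum>q<a. of_bool (Suc q * c \<le> a)) = a div c" if "0 < c" for a c :: nat
  proof -
    have *: "Suc q * c \<le> a \<longleftrightarrow> q < a div c" for q
      using less_eq_div_iff_mult_less_eq[OF that, of "Suc q" a] by (simp only: Suc_le_eq)
    have "{..<a} \<inter> {q. q < a div c} = {..<a div c}"
      using div_le_dividend[of a c] by (force intro: less_le_trans)
    then show ?thesis unfolding * by (simp add: Groups_Big.sum_of_bool_eq)
  qed
  ultimately show ?thesis
    by (elim recursive_cong) (simp del: mult_Suc)
qed

text \<open>With divisor \<open>0\<close> the subtracted product is \<open>0\<close>, in agreement with \<open>a mod 0 = a\<close>.\<close>

lemma recursive_mod:
  assumes "recursive n f" "recursive n g"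
  shows "recursive n (\<lambda>xs. f xs mod g xs)"
proof -
  have "recursive n (\<lambda>xs. f xs - f xs div g xs * g xs)"
    using assms by (intro recursive_diff recursive_mult recursive_div)
  then show ?thesis by (simp add: minus_div_mult_eq_mod)
qed

lemmas recursive_intros = recursive_const recursive_hd_tl recursive_nth_tl recursive_Suc recursive_add recursive_mult
  recursive_diff recursive_power recursive_div recursive_mod recursive_le recursive_eq recursive_sum

lemma recursive_app2:
  assumes "recursive 2 (\<lambda>xs. f (xs ! 0) (xs ! 1))" "recursive n g" "recursive n h"
  shows "recursive n (\<lambda>xs. f (g xs) (h xs))"
  using recursive_subst[of "[g, h]" "\<lambda>xs. f (xs ! 0) (xs ! 1)" n] assms by (simp add: numeral_eq_Suc)

lemma recursive_app3:
  assumes "recursive 3 (\<lambda>xs. f (xs ! 0) (xs ! 1) (xs ! 2))" "recursive n g" "recursive n h" "recursive n k"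
  shows "recursive n (\<lambda>xs. f (g xs) (h xs) (k xs))"
  using recursive_subst[of "[g, h, k]" "\<lambda>xs. f (xs ! 0) (xs ! 1) (xs ! 2)" n] assms
  by (simp add: numeral_eq_Suc)

lemma recursive_app4:
  assumes "recursive 4 (\<lambda>xs. f (xs ! 0) (xs ! 1) (xs ! 2) (xs ! 3))"
    "recursive n g" "recursive n h" "recursive n k" "recursive n l"
  shows "recursive n (\<lambda>xs. f (g xs) (h xs) (k xs) (l xs))"
  using recursive_subst[of "[g, h, k, l]" "\<lambda>xs. f (xs ! 0) (xs ! 1) (xs ! 2) (xs ! 3)" n] assms
  by (simp add: numeral_eq_Suc)

lemma recursive_fun_upd:
  assumes "recursive 1 (\<lambda>xs. x (xs ! 0))"
  shows "recursive 1 (\<lambda>xs. (x(N := a)) (xs ! 0))"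
proof -
  have "recursive 1 (\<lambda>xs. of_bool (xs ! 0 = N) * a + (1 - of_bool (xs ! 0 = N)) * x (xs ! 0))"
    using assms by (intro recursive_intros) simp_all
  then show ?thesis by (rule recursive_cong) auto
qed

section \<open>Averages over the next symbols\<close>

locale digits =
  fixes b :: nat
  assumes b_ge_2: "2 \<le> b"
begin

text \<open>The conditional expectation of \<open>F\<close> when the first \<open>n\<close> symbols are those of \<open>x\<close>, the next \<open>m\<close> are
  independent and uniform, and the later ones are again those of \<open>x\<close>. In the applications \<open>F\<close>
  does not depend on the later ones.\<close>

primrec ave :: "nat \<Rightarrow> nat \<Rightarrow> ((nat \<Rightarrow> nat) \<Rightarrow> real) \<Rightarrow> (nat \<Rightarrow> nat) \<Rightarrow> real" where
  "ave 0 n F x = F x"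
| "ave (Suc m) n F x = (\<Sum>a<b. ave m (Suc n) F (x(n := a))) / b"

text \<open>The sequences over which \<open>ave m n F x\<close> averages \<open>F\<close>.\<close>

definition fibre :: "nat \<Rightarrow> nat \<Rightarrow> (nat \<Rightarrow> nat) \<Rightarrow> (nat \<Rightarrow> nat) set" where
  "fibre m n x = {y. (\<forall>t. t \<notin> {n..<n + m} \<longrightarrow> y t = x t) \<and> (\<forall>t\<in>{n..<n + m}. y t < b)}"

definition depends_below :: "nat \<Rightarrow> ((nat \<Rightarrow> nat) \<Rightarrow> 'c) \<Rightarrow> bool" where
  "depends_below L F \<longleftrightarrow> (\<forall>x y. (\<forall>t<L. x t = y t) \<longrightarrow> F x = F y)"

lemma depD: "depends_below L F \<Longrightarrow> (\<And>t. t < L \<Longrightarrow> x t = y t) \<Longrightarrow> F x = F y"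
  unfolding depends_below_def by blast

lemma dep_mono: "depends_below L F \<Longrightarrow> L \<le> L' \<Longrightarrow> depends_below L' F"
  unfolding depends_below_def by (meson less_le_trans)

lemma b_pos: "0 < b" "0 < real b" "1 < real b"
  using b_ge_2 by auto

lemma fibre_Suc:
  assumes "a < b" "y \<in> fibre m (Suc n) (x(n := a))"
  shows "y \<in> fibre (Suc m) n x" "y n = a"
proof -
  show "y n = a" using assms by (auto simp: fibre_def)
  show "y \<in> fibre (Suc m) n x"
    unfolding fibre_def mem_Collect_eq
  proof (intro conjI allI impI ballI)
    fix t assume "t \<notin> {n..<n + Suc m}"
    then show "y t = x t" using assms(2) by (auto simp: fibre_def split: if_splits)
  next
    fix t assume t: "t \<in> {n..<n + Suc m}"
    show "y t < b"
    proof (cases "t = n")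
      case True
      then show ?thesis using \<open>y n = a\<close> assms(1) by simp
    next
      case False
      then show ?thesis using t assms(2) by (auto simp: fibre_def)
    qed
  qed
qed

lemma ave_mono:
  assumes "\<And>y. y \<in> fibre m n x \<Longrightarrow> F y \<le> G y"
  shows "ave m n F x \<le> ave m n G x"
  using assms
proof (induction m arbitrary: n x)
  case 0
  show ?case using 0[of x] by (simp add: fibre_def)
next
  case (Suc m)
  have "ave m (Suc n) F (x(n := a)) \<le> ave m (Suc n) G (x(n := a))" if "a < b" for a
    by (rule Suc.IH) (use fibre_Suc[OF that] Suc.prems in blast)
  then show ?case by (auto intro!: divide_right_mono sum_mono)
qed

lemma ave_cong:
  assumes "\<And>y. y \<in> fibre m n x \<Longrightarrow> F y = G y"
  shows "ave m n F x = ave m n G x"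
  using ave_mono[of m n x F G] ave_mono[of m n x G F] assms by force

lemma ave_const: "ave m n (\<lambda>y. c) x = c"
  by (induction m arbitrary: n x) (use b_pos in auto)

lemma ave_plus: "ave m n (\<lambda>y. F y + G y) x = ave m n F x + ave m n G x"
  by (induction m arbitrary: n x) (auto simp: sum.distrib add_divide_distrib)

lemma ave_scale: "ave m n (\<lambda>y. c * F y) x = c * ave m n F x"
  by (induction m arbitrary: n x) (auto simp: sum_distrib_left)

lemma ave_uminus: "ave m n (\<lambda>y. - F y) x = - ave m n F x"
  using ave_scale[of m n "-1" F x] by simp

lemma ave_minus: "ave m n (\<lambda>y. F y - G y) x = ave m n F x - ave m n G x"
  using ave_plus[of m n F "\<lambda>y. - G y" x] by (simp add: ave_uminus)

lemma ave_sum: "ave m n (\<lambda>y. \<Sum>i\<in>I. F i y) x = (\<Sum>i\<in>I. ave m n (F i) x)"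
  by (induction I rule: infinite_finite_induct) (auto simp: ave_const ave_plus)

lemma ave_abs: "\<bar>ave m n F x\<bar> \<le> ave m n (\<lambda>y. \<bar>F y\<bar>) x"
proof (rule abs_leI)
  show "ave m n F x \<le> ave m n (\<lambda>y. \<bar>F y\<bar>) x" by (rule ave_mono) simp
  have "ave m n (\<lambda>y. - F y) x \<le> ave m n (\<lambda>y. \<bar>F y\<bar>) x" by (rule ave_mono) simp
  then show "- ave m n F x \<le> ave m n (\<lambda>y. \<bar>F y\<bar>) x" by (simp only: ave_uminus)
qed

lemma ave_add: "ave (m + l) n F x = ave m n (ave l (n + m) F) x"
  by (induction m arbitrary: n x) auto

lemma ave_dep:
  assumes "depends_below (n + m) F" "\<And>t. t < n \<Longrightarrow> x t = y t"
  shows "ave m n F x = ave m n F y"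
  using assms
proof (induction m arbitrary: n x y)
  case 0
  have "F x = F y" by (rule depD[OF 0(1)]) (simp add: 0(2))
  then show ?case by simp
next
  case (Suc m)
  have "ave m (Suc n) F (x(n := a)) = ave m (Suc n) F (y(n := a))" for a
  proof (rule Suc.IH)
    show "depends_below (Suc n + m) F" using Suc.prems(1) by simp
    show "(x(n := a)) t = (y(n := a)) t" if "t < Suc n" for t
      using that Suc.prems(2)[of t] by (cases "t = n") auto
  qed
  then show ?case by simp
qed

lemma ave_pad:
  assumes "depends_below (n + m) F" "m \<le> m'"
  shows "ave m' n F x = ave m n F x"
proof -
  have "ave l (n + m) F y = F y" for l y
  proof -
    have "ave l (n + m) F y = ave l (n + m) (\<lambda>_. F y) y"
      by (rule ave_cong) (auto simp: fibre_def intro!: depD[OF assms(1)])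
    then show ?thesis by (simp add: ave_const)
  qed
  then have "ave (m + (m' - m)) n F x = ave m n F x"
    unfolding ave_add by (intro arg_cong[of _ _ "\<lambda>G. ave m n G x"] ext) simp
  then show ?thesis using assms(2) by simp
qed

text \<open>Guess every new symbol from its predecessors. Whatever the past, the guess is right with
  probability \<open>1 / b\<close>, so \<open>m\<close> guesses in a row are all right with probability \<open>1 / b ^ m\<close>.
  Guessing the letters of a fixed word gives the probability of that word; guessing the symbol
  \<open>d\<close> places earlier gives the probability that two blocks at distance \<open>d\<close> coincide.\<close>

lemma ave_guess:
  assumes "\<And>t. x t < b"
    and "\<And>y z t. (\<And>s. s < t \<Longrightarrow> y s = z s) \<Longrightarrow> \<phi> y t = \<phi> z t"
    and "\<And>y t. (\<And>s. y s < b) \<Longrightarrow> n \<le> t \<Longrightarrow> t < n + m \<Longrightarrow> \<phi> y t < b"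
  shows "ave m n (\<lambda>y. of_bool (\<forall>t\<in>{n..<n + m}. y t = \<phi> y t)) x = 1 / b ^ m"
  using assms(1,3)
proof (induction m arbitrary: n x)
  case 0
  then show ?case by simp
next
  case (Suc m)
  have "ave m (Suc n) (\<lambda>y. of_bool (\<forall>t\<in>{n..<n + Suc m}. y t = \<phi> y t)) (x(n := a))
      = of_bool (a = \<phi> x n) * (1 / b ^ m)" if "a < b" for a
  proof -
    have "ave m (Suc n) (\<lambda>y. of_bool (\<forall>t\<in>{n..<n + Suc m}. y t = \<phi> y t)) (x(n := a))
       = ave m (Suc n) (\<lambda>y. of_bool (a = \<phi> x n) *
            of_bool (\<forall>t\<in>{Suc n..<Suc n + m}. y t = \<phi> y t)) (x(n := a))"
    proof (rule ave_cong)
      fix y assume y: "y \<in> fibre m (Suc n) (x(n := a))"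
      have "y n = a" using fibre_Suc(2)[OF that y] .
      moreover have "\<phi> y n = \<phi> x n"
        by (rule assms(2)) (use y in \<open>auto simp: fibre_def\<close>)
      moreover have "{n..<n + Suc m} = insert n {Suc n..<Suc n + m}" by auto
      ultimately show "of_bool (\<forall>t\<in>{n..<n + Suc m}. y t = \<phi> y t) =
          of_bool (a = \<phi> x n) * (of_bool (\<forall>t\<in>{Suc n..<Suc n + m}. y t = \<phi> y t) :: real)"
        by simp
    qed
    also have "\<dots> = of_bool (a = \<phi> x n) * (1 / b ^ m)"
      unfolding ave_scale by (subst Suc.IH) (use Suc.prems that in auto)
    finally show ?thesis .
  qed
  then have "ave (Suc m) n (\<lambda>y. of_bool (\<forall>t\<in>{n..<n + Suc m}. y t = \<phi> y t)) x
      = (\<Sum>a<b. of_bool (a = \<phi> x n) * (1 / b ^ m)) / b"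
    by simp
  also have "\<dots> = (\<Sum>a<b. of_bool (a = \<phi> x n)) * (1 / b ^ m) / b"
    by (simp only: sum_distrib_right)
  also have "(\<Sum>a<b. of_bool (a = \<phi> x n)) = (1::real)"
    using Suc.prems(2)[of x n] Suc.prems(1) by (simp add: of_bool_def)
  finally show ?case by simp
qed

text \<open>A bound for the effect of altering one symbol, uniform over positions.\<close>

definition osc_le :: "real \<Rightarrow> ((nat \<Rightarrow> nat) \<Rightarrow> real) \<Rightarrow> bool" where
  "osc_le \<delta> F \<longleftrightarrow> (\<forall>x t a. \<bar>F (x(t := a)) - F x\<bar> \<le> \<delta>)"

lemma ave_change:
  assumes "osc_le \<delta> F"
  shows "\<bar>ave m n F (x(t := a)) - ave m n F x\<bar> \<le> \<delta>"
proof (induction m arbitrary: n x)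
  case 0
  then show ?case using assms by (simp add: osc_le_def fun_upd_def)
next
  case (Suc m)
  \<comment> \<open>If \<open>t = n\<close>, the alteration is overwritten; otherwise the two updates commute.\<close>
  have le: "\<bar>ave m (Suc n) F ((x(t := a))(n := c)) - ave m (Suc n) F (x(n := c))\<bar> \<le> \<delta>" for c
  proof (cases "t = n")
    case True
    have "0 \<le> \<delta>" using Suc.IH[of 0 x] by linarith
    with True show ?thesis by simp
  next
    case False
    then have "(x(t := a))(n := c) = (x(n := c))(t := a)" by auto
    then show ?thesis using Suc.IH[of "Suc n" "x(n := c)"] by (simp only:)
  qed
  have "\<bar>\<Sum>c<b. ave m (Suc n) F ((x(t := a))(n := c)) - ave m (Suc n) F (x(n := c))\<bar> \<le> (\<Sum>c<b. \<delta>)"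
    by (rule order.trans[OF sum_abs sum_mono]) (rule le)
  then have "\<bar>(\<Sum>c<b. ave m (Suc n) F ((x(t := a))(n := c)) - ave m (Suc n) F (x(n := c))) / b\<bar> \<le> \<delta>"
    using b_pos by (simp add: field_simps)
  then show ?case by (simp only: sum_subtractf diff_divide_distrib ave.simps)
qed

text \<open>The successive conditional expectations form a martingale with differences bounded by \<open>\<delta>\<close>.\<close>

lemma ave_step:
  assumes "osc_le \<delta> F"
  shows "\<bar>ave m (Suc n) F x - ave (Suc m) n F x\<bar> \<le> \<delta>"
proof -
  have "\<bar>\<Sum>a<b. ave m (Suc n) F x - ave m (Suc n) F (x(n := a))\<bar> \<le> (\<Sum>a<b. \<delta>)"
    by (rule order.trans[OF sum_abs sum_mono]) (use ave_change[OF assms] in \<open>simp add: abs_minus_commute\<close>)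
  then have "\<bar>(\<Sum>a<b. ave m (Suc n) F x - ave m (Suc n) F (x(n := a))) / b\<bar> \<le> \<delta>"
    using b_pos by (simp add: field_simps)
  then show ?thesis using b_pos by (simp add: sum_subtractf diff_divide_distrib)
qed

text \<open>Revealing a prefix of length \<open>n\<close> moves the expectation by at most \<open>\<delta>\<close> per symbol. This is what
  allows a level to be taken into account only after \<open>n\<close> symbols have been fixed without regard
  to it.\<close>

lemma ave_bias:
  assumes "osc_le \<delta> F"
  shows "\<bar>ave m n F x - ave (m + n) 0 F x\<bar> \<le> n * \<delta>"
proof (induction n arbitrary: m)
  case (Suc n)
  show ?case using Suc[of "Suc m"] ave_step[OF assms, of m n x] by (simp add: algebra_simps)
qed simp

text \<open>The variance of a function of independent symbols is the sum of the mean squares of the martingale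
  differences, each of which is at most \<open>\<delta>\<^sup>2\<close>. Keeping the centre \<open>c\<close> arbitrary lets the induction
  run over the conditional expectations, all with the same \<open>c\<close>.\<close>

lemma ave_square:
  assumes "osc_le \<delta> F"
  shows "ave m n (\<lambda>y. (F y - c)\<^sup>2) x \<le> (ave m n F x - c)\<^sup>2 + m * \<delta>\<^sup>2"
proof (induction m arbitrary: n x)
  case 0
  then show ?case by simp
next
  case (Suc m)
  let ?D = "\<lambda>a. ave m (Suc n) F (x(n := a))" and ?A = "ave (Suc m) n F x"
  have A: "(\<Sum>a<b. ?D a) = b * ?A" using b_pos by simp
  \<comment> \<open>Altering \<open>x n\<close> does not affect the average over \<open>x n\<close>, so \<open>ave_step\<close> applies to each branch.\<close>
  have dev: "(?D a - ?A)\<^sup>2 \<le> \<delta>\<^sup>2" for a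
  proof -
    have "ave (Suc m) n F (x(n := a)) = ?A" by simp
    then have "\<bar>?D a - ?A\<bar> \<le> \<delta>" using ave_step[OF assms, of m n "x(n := a)"] by simp
    then show ?thesis by (metis abs_ge_zero abs_le_square_iff abs_of_nonneg order.trans)
  qed
  have "(\<Sum>a<b. ave m (Suc n) (\<lambda>y. (F y - c)\<^sup>2) (x(n := a)))
      \<le> (\<Sum>a<b. (?D a - c)\<^sup>2 + m * \<delta>\<^sup>2)"
    by (intro sum_mono Suc.IH)
  also have "\<dots> = (\<Sum>a<b. (?D a - ?A)\<^sup>2 + 2 * (?A - c) * ?D a + (c\<^sup>2 - ?A\<^sup>2) + m * \<delta>\<^sup>2)"
    by (intro sum.cong refl) (simp add: power2_eq_square algebra_simps)
  also have "\<dots> \<le> (\<Sum>a<b. \<delta>\<^sup>2 + 2 * (?A - c) * ?D a + (c\<^sup>2 - ?A\<^sup>2) + m * \<delta>\<^sup>2)"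
    by (intro sum_mono add_right_mono dev)
  also have "\<dots> = b * \<delta>\<^sup>2 + 2 * (?A - c) * (\<Sum>a<b. ?D a) + b * (c\<^sup>2 - ?A\<^sup>2) + b * (m * \<delta>\<^sup>2)"
    by (simp add: sum.distrib sum_distrib_left del: ave.simps)
  also have "\<dots> = b * ((?A - c)\<^sup>2 + Suc m * \<delta>\<^sup>2)"
    unfolding A by (simp add: power2_eq_square algebra_simps del: ave.simps)
  finally have "(\<Sum>a<b. ave m (Suc n) (\<lambda>y. (F y - c)\<^sup>2) (x(n := a))) / b \<le> (?A - c)\<^sup>2 + Suc m * \<delta>\<^sup>2"
    using b_pos by (simp add: field_simps del: ave.simps)
  then show ?case by (simp only: ave.simps)
qed

text \<open>Here a random digit is replaced by a chosen one that does at least as well.\<close>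

lemma exists_digit_le_ave: "\<exists>a<b. ave m (Suc n) F (x(n := a)) \<le> ave (Suc m) n F x"
proof (rule ccontr)
  assume "\<not> ?thesis"
  then have "\<And>a. a \<in> {..<b} \<Longrightarrow> ave (Suc m) n F x < ave m (Suc n) F (x(n := a))"
    by (auto simp: not_le simp del: ave.simps)
  then have "(\<Sum>a<b. ave (Suc m) n F x) < (\<Sum>a<b. ave m (Suc n) F (x(n := a)))"
    using b_pos by (intro sum_strict_mono) auto
  then show False using b_pos by simp
qed

end

section \<open>Blocks and their frequencies\<close>

context digits
begin

definition dig :: "nat \<Rightarrow> nat \<Rightarrow> nat" where
  "dig u t = u div b ^ t mod b"

text \<open>Blocks are coded as numbers below \<open>b ^ k\<close>, first symbol least significant. For a sequence of digits
  of a number \<open>u\<close> this makes a block the number \<open>u div b ^ j mod b ^ k\<close>. Positions start at \<open>0\<close>.\<close>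

definition blk :: "nat \<Rightarrow> (nat \<Rightarrow> nat) \<Rightarrow> nat \<Rightarrow> nat" where
  "blk k x j = (\<Sum>t<k. x (j + t) * b ^ t)"

definition hits :: "nat \<Rightarrow> nat \<Rightarrow> (nat \<Rightarrow> nat) \<Rightarrow> nat \<Rightarrow> nat" where
  "hits k T x w = (\<Sum>j<T. of_bool (blk k x j = w))"

definition freq :: "nat \<Rightarrow> nat \<Rightarrow> nat \<Rightarrow> (nat \<Rightarrow> nat) \<Rightarrow> real" where
  "freq k T i x = (\<Sum>w<b ^ k. of_bool (hits k T x w = i)) / b ^ k"

text \<open>The first \<open>T + k\<close> symbols determine the frequency, so averaging over them gives its expectation
  over random sequences.\<close>

definition mean :: "nat \<Rightarrow> nat \<Rightarrow> nat \<Rightarrow> real" where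
  "mean k T i = ave (T + k) 0 (freq k T i) (\<lambda>_. 0)"

lemma dig_less: "dig u t < b"
  using b_pos by (simp add: dig_def)

lemma dig_eq_mod: "(\<Sum>t<k. dig u (j + t) * b ^ t) = u div b ^ j mod b ^ k"
proof (induction k)
  case (Suc k)
  have "u div b ^ j mod b ^ Suc k = b ^ k * (u div b ^ j div b ^ k mod b) + u div b ^ j mod b ^ k"
    by (simp add: mod_mult2_eq mult.commute[of b])
  also have "u div b ^ j div b ^ k = u div b ^ (j + k)"
    by (simp add: div_mult2_eq power_add)
  finally show ?case using Suc by (simp add: dig_def)
qed simp

lemma blk_dig: "blk k (dig u) j = u div b ^ j mod b ^ k"
  unfolding blk_def by (rule dig_eq_mod)

lemma blk_cong: "(\<And>t. t < k \<Longrightarrow> x (j + t) = y (j + t)) \<Longrightarrow> blk k x j = blk k y j"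
  by (simp add: blk_def)

lemma blk_less:
  assumes "\<And>t. x t < b"
  shows "blk k x j < b ^ k"
proof (induction k)
  case (Suc k)
  have "blk (Suc k) x j < b ^ k + x (j + k) * b ^ k"
    using Suc by (simp add: blk_def)
  also have "\<dots> = Suc (x (j + k)) * b ^ k" by simp
  also have "\<dots> \<le> b * b ^ k"
    using assms[of "j + k"] by (intro mult_right_mono) auto
  finally show ?case by simp
qed (simp add: blk_def)

lemma dig_blk:
  assumes "\<And>t. x t < b" "t < k"
  shows "dig (blk k x j) t = x (j + t)"
  using assms(2)
proof (induction k)
  case (Suc k)
  have less: "blk k x j < b ^ k" by (rule blk_less[OF assms(1)])
  have eq: "blk (Suc k) x j = blk k x j + x (j + k) * b ^ k" by (simp add: blk_def)
  show ?case
  proof (cases "t = k")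
    case True
    then show ?thesis
      unfolding eq dig_def using less assms(1)[of "j + k"] b_pos by simp
  next
    case False
    then have t: "t < k" using Suc.prems by simp
    then have "b ^ k = b ^ (t + 1 + (k - Suc t))"
      by simp
    then have "b ^ k = b ^ t * b * b ^ (k - Suc t)"
      by (simp only: power_add power_one_right)
    then have "blk (Suc k) x j = blk k x j + b ^ t * (b * (b ^ (k - Suc t) * x (j + k)))"
      unfolding eq by (simp add: ac_simps)
    then have "dig (blk (Suc k) x j) t = dig (blk k x j) t"
      unfolding dig_def using b_pos by simp
    then show ?thesis using Suc.IH[OF t] by simp
  qed
qed simp

lemma blk_eq_iff:
  assumes "\<And>t. x t < b" "\<And>t. y t < b"
  shows "blk k x i = blk k y j \<longleftrightarrow> (\<forall>t<k. x (i + t) = y (j + t))"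
proof
  assume "blk k x i = blk k y j"
  then show "\<forall>t<k. x (i + t) = y (j + t)"
    using dig_blk[of x, OF assms(1)] dig_blk[of y, OF assms(2)] by metis
qed (simp add: blk_def)

lemma blk_eq_word_iff:
  assumes "\<And>t. x t < b" "w < b ^ k"
  shows "blk k x j = w \<longleftrightarrow> (\<forall>t<k. x (j + t) = dig w t)"
  using blk_eq_iff[of x "dig w" k j 0] dig_less blk_dig[of k w 0] assms by simp

lemma dep_hits: "T + k \<le> Suc H \<Longrightarrow> depends_below H (\<lambda>x. hits k T x w)"
  unfolding depends_below_def hits_def
proof (intro allI impI sum.cong refl)
  fix x y :: "nat \<Rightarrow> nat" and j
  assume "T + k \<le> Suc H" "\<forall>t<H. x t = y t" "j \<in> {..<T}"
  then have "blk k x j = blk k y j" by (intro blk_cong) auto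
  then show "of_bool (blk k x j = w) = (of_bool (blk k y j = w) :: nat)" by simp
qed

lemma dep_freq: "T + k \<le> Suc H \<Longrightarrow> depends_below H (freq k T i)"
proof -
  assume *: "T + k \<le> Suc H"
  show "depends_below H (freq k T i)"
    unfolding depends_below_def
  proof (intro allI impI)
    fix x y :: "nat \<Rightarrow> nat" assume "\<forall>t<H. x t = y t"
    then have "hits k T x w = hits k T y w" for w
      by (intro depD[OF dep_hits[OF *]]) auto
    then show "freq k T i x = freq k T i y" by (simp add: freq_def)
  qed
qed

lemma mean_eq:
  assumes "T + k \<le> Suc H"
  shows "mean k T i = ave H 0 (freq k T i) x"
proof -
  have "mean k T i = ave (T + k + H) 0 (freq k T i) (\<lambda>_. 0)"
    unfolding mean_def by (rule ave_pad[symmetric]) (auto intro: dep_freq)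
  also have "\<dots> = ave (T + k + H) 0 (freq k T i) x"
    by (rule ave_dep) (auto intro: dep_freq)
  also have "\<dots> = ave H 0 (freq k T i) x"
    by (rule ave_pad) (auto intro: dep_freq assms)
  finally show ?thesis .
qed

text \<open>A word counted differently in the two situations is one of the blocks at a position in \<open>J\<close>,
  and there are at most \<open>2 * card J\<close> of these.\<close>

lemma freq_diff:
  assumes "finite J"
    and "\<And>w. hits k T x w \<noteq> hits k T' y w \<Longrightarrow> \<exists>j\<in>J. blk k x j = w \<or> blk k y j = w"
  shows "\<bar>freq k T i x - freq k T' i y\<bar> \<le> 2 * card J / b ^ k"
proof -
  let ?D = "blk k x ` J \<union> blk k y ` J"
  have "\<bar>(\<Sum>w<b ^ k. of_bool (hits k T x w = i) - of_bool (hits k T' y w = i) :: real)\<bar>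
      \<le> (\<Sum>w<b ^ k. of_bool (w \<in> ?D))"
  proof (rule order.trans[OF sum_abs sum_mono])
    fix w
    have "w \<in> ?D" if "hits k T x w \<noteq> hits k T' y w"
      using assms(2)[OF that] by auto
    then show "\<bar>of_bool (hits k T x w = i) - of_bool (hits k T' y w = i)\<bar> \<le> (of_bool (w \<in> ?D) :: real)"
      by (cases "hits k T x w = hits k T' y w") auto
  qed
  also have "\<dots> = card ({..<b ^ k} \<inter> ?D)" 
    by (subst Groups_Big.sum_of_bool_eq) (simp_all only: finite_lessThan Collect_mem_eq)
  also have "card ({..<b ^ k} \<inter> ?D) \<le> card ?D"
    using assms(1) by (intro card_mono) auto
  also have "card ?D \<le> card J + card J"
    using card_image_le[OF assms(1), of "blk k x"] card_image_le[OF assms(1), of "blk k y"]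
    by (intro order.trans[OF card_Un_le] add_mono)
  finally have "\<bar>(\<Sum>w<b ^ k. of_bool (hits k T x w = i) - of_bool (hits k T' y w = i) :: real)\<bar>
      \<le> 2 * card J" by simp
  then have "\<bar>(\<Sum>w<b ^ k. of_bool (hits k T x w = i) - of_bool (hits k T' y w = i) :: real)\<bar> / b ^ k
      \<le> 2 * card J / b ^ k" by (rule divide_right_mono) simp
  then show ?thesis
    unfolding freq_def by (simp add: sum_subtractf diff_divide_distrib[symmetric])
qed

text \<open>Only the blocks starting in the \<open>k\<close> positions up to \<open>t\<close> see the symbol at \<open>t\<close>.\<close>

lemma freq_upd: "\<bar>freq k T i (x(t := a)) - freq k T i x\<bar> \<le> 2 * k / b ^ k"
proof -
  \<comment> \<open>Truncated subtraction cuts the window off at position \<open>0\<close>.\<close>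
  let ?J = "{t + 1 - k..<t + 1}"
  have unhit: "blk k (x(t := a)) j = blk k x j" if "j \<notin> ?J" for j
    by (rule blk_cong) (use that in auto)
  have "\<bar>freq k T i (x(t := a)) - freq k T i x\<bar> \<le> 2 * card ?J / b ^ k"
  proof (rule freq_diff)
    fix w assume "hits k T (x(t := a)) w \<noteq> hits k T x w"
    then have "\<exists>j<T. (blk k (x(t := a)) j = w) \<noteq> (blk k x j = w)"
    proof (rule contrapos_np)
      assume "\<not> (\<exists>j<T. (blk k (x(t := a)) j = w) \<noteq> (blk k x j = w))"
      then show "hits k T (x(t := a)) w = hits k T x w"
        unfolding hits_def by (intro sum.cong) auto
    qed
    then show "\<exists>j\<in>?J. blk k (x(t := a)) j = w \<or> blk k x j = w"
    proof (elim exE conjE)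
      fix j assume j: "(blk k (x(t := a)) j = w) \<noteq> (blk k x j = w)"
      then have "j \<in> ?J" using unhit[of j] by force
      then show ?thesis using j by blast
    qed
  qed simp
  also have "2 * card ?J / b ^ k \<le> 2 * k / b ^ k"
    by (intro divide_right_mono) auto
  finally show ?thesis by simp
qed

lemma osc_le_freq: "osc_le (2 * k / b ^ k) (freq k T i)"
  unfolding osc_le_def using freq_upd by blast

lemma hits_mono_diff:
  assumes "T \<le> T'"
  shows "hits k T' x w = hits k T x w + (\<Sum>j\<in>{T..<T'}. of_bool (blk k x j = w))"
  unfolding hits_def
  using sum.atLeastLessThan_concat[of 0 T T' "\<lambda>j. of_bool (blk k x j = w) :: nat"] assms
  by (simp only: atLeast0LessThan)

lemma freq_window:
  assumes "T \<le> T'"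
  shows "\<bar>freq k T i x - freq k T' i x\<bar> \<le> 2 * (T' - T) / b ^ k"
proof -
  have "\<bar>freq k T i x - freq k T' i x\<bar> \<le> 2 * card {T..<T'} / b ^ k"
    by (rule freq_diff) (auto simp: hits_mono_diff[OF assms])
  then show ?thesis using assms by (simp add: of_nat_diff)
qed

end

section \<open>Expected frequencies\<close>

text \<open>The law of rare events, pointwise. It splits into \<open>(T choose i) * p ^ i\<close>, treated by induction on
  \<open>i\<close>, and a power of \<open>1 - p\<close>, treated by \<open>ln (1 - p) / p \<longlongrightarrow> -1\<close>.\<close>

lemma binomial_tendsto_Poisson:
  fixes T :: "nat \<Rightarrow> nat" and p :: "nat \<Rightarrow> real"
  assumes "p \<longlonglongrightarrow> 0" "\<And>n. 0 < p n" "\<And>n. p n < 1" "(\<lambda>n. T n * p n) \<longlonglongrightarrow> lam"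
  shows "(\<lambda>n. (T n choose i) * p n ^ i * (1 - p n) ^ (T n - i)) \<longlonglongrightarrow> exp (- lam) * lam ^ i / fact i"
proof -
  have choose: "(\<lambda>n. (T n choose i) * p n ^ i) \<longlonglongrightarrow> lam ^ i / fact i"
  proof (induction i)
    case (Suc i)
    have eq: "real (T n choose Suc i) = real (T n choose i) * (real (T n) - i) / Suc i" for n
    proof (cases "i \<le> T n")
      case True
      have "Suc i * (T n choose Suc i) = (T n - i) * (T n choose i)"
        by (metis binomial_absorb_comp binomial_absorption)
      then have "real (Suc i) * real (T n choose Suc i) = (real (T n) - i) * real (T n choose i)"
        using True by (metis of_nat_diff of_nat_mult)
      then show ?thesis by (simp add: field_simps)
    qed (simp add: binomial_eq_0)
    have "(\<lambda>n. (T n choose i) * p n ^ i * (T n * p n - i * p n) / Suc i)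
        \<longlonglongrightarrow> lam ^ i / fact i * (lam - real i * 0) / real (Suc i)"
      by (intro tendsto_intros Suc assms) simp_all
    then show ?case by (simp add: eq algebra_simps)
  qed simp
  have "((\<lambda>p::real. ln (1 - p) / p) \<longlongrightarrow> -1) (at_right 0)" by real_asymp
  moreover have "filterlim p (at_right 0) sequentially"
    using assms(1,2) by (auto simp: filterlim_at intro!: always_eventually less_imp_neq[symmetric])
  ultimately have "(\<lambda>n. ln (1 - p n) / p n) \<longlonglongrightarrow> -1"
    by (rule filterlim_compose)
  then have "(\<lambda>n. exp (T n * p n * (ln (1 - p n) / p n))) \<longlonglongrightarrow> exp (lam * -1)"
    by (intro tendsto_intros assms)
  moreover have "exp (T n * p n * (ln (1 - p n) / p n)) = (1 - p n) ^ T n" for n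
    using assms(2,3)[of n] by (simp add: exp_of_nat_mult exp_ln)
  ultimately have "(\<lambda>n. (1 - p n) ^ T n) \<longlonglongrightarrow> exp (- lam)" by simp
  then have "(\<lambda>n. (T n choose i) * p n ^ i * ((1 - p n) ^ T n / (1 - p n) ^ i))
      \<longlonglongrightarrow> lam ^ i / fact i * (exp (- lam) / (1 - 0) ^ i)"
    by (intro tendsto_intros choose assms) auto
  moreover have "(T n choose i) * p n ^ i * ((1 - p n) ^ T n / (1 - p n) ^ i)
      = (T n choose i) * p n ^ i * (1 - p n) ^ (T n - i)" for n
    using assms(3)[of n] by (cases "i \<le> T n") (auto simp: power_diff binomial_eq_0)
  ultimately show ?thesis by (simp add: mult.commute)
qed

context digits
begin

definition prob :: "nat \<Rightarrow> ((nat \<Rightarrow> nat) \<Rightarrow> bool) \<Rightarrow> real" where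
  "prob H P = ave H 0 (\<lambda>x. of_bool (P x)) (\<lambda>_. 0)"

lemma fibre0_less: "y \<in> fibre H 0 (\<lambda>_. 0) \<Longrightarrow> y t < b"
  using b_pos by (cases "t < H") (auto simp: fibre_def)

lemma ave_blk_eq:
  assumes "\<And>t. x t < b" "w < b ^ k"
  shows "ave k j (\<lambda>y. of_bool (blk k y j = w)) x = 1 / b ^ k"
proof -
  have "ave k j (\<lambda>y. of_bool (blk k y j = w)) x
      = ave k j (\<lambda>y. of_bool (\<forall>t\<in>{j..<j + k}. y t = dig w (t - j))) x"
  proof (rule ave_cong)
    fix y assume "y \<in> fibre k j x"
    then have y: "y t < b" for t using assms(1)[of t] by (cases "t \<in> {j..<j + k}") (auto simp: fibre_def)
    have "(\<forall>t\<in>{j..<j + k}. y t = dig w (t - j)) \<longleftrightarrow> (\<forall>t<k. y (j + t) = dig w t)"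
    proof safe
      fix t assume "\<forall>t\<in>{j..<j + k}. y t = dig w (t - j)" "t < k"
      then show "y (j + t) = dig w t" by (auto dest: bspec[of _ _ "j + t"])
    next
      fix t assume "\<forall>t<k. y (j + t) = dig w t" "t \<in> {j..<j + k}"
      then show "y t = dig w (t - j)" by (auto dest: spec[of _ "t - j"])
    qed
    then show "of_bool (blk k y j = w) = of_bool (\<forall>t\<in>{j..<j + k}. y t = dig w (t - j))"
      by (simp add: blk_eq_word_iff[OF y assms(2)])
  qed
  also have "\<dots> = 1 / b ^ k"
    by (rule ave_guess[where \<phi> = "\<lambda>y t. dig w (t - j)"]) (auto intro: assms dig_less)
  finally show ?thesis .
qed

text \<open>\<open>P\<close> looks only at symbols before the block at \<open>T\<close>, so the block is fresh.\<close>

lemma prob_blk_word_indep: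
  assumes "w < b ^ k" and "depends_below T P" and "T + k \<le> H"
  shows "prob H (\<lambda>x. blk k x T = w \<and> P x) = 1 / b ^ k * prob H P"
proof -
  have d: "depends_below (T + k) (\<lambda>x. blk k x T = w)"
    unfolding depends_below_def by (intro allI impI arg_cong[of _ _ "\<lambda>v. v = w"] blk_cong) simp
  have d': "depends_below (T + k) P" by (rule dep_mono[OF assms(2)]) simp
  have "prob H (\<lambda>x. blk k x T = w \<and> P x) = ave (T + k) 0 (\<lambda>x. of_bool (blk k x T = w \<and> P x)) (\<lambda>_. 0)"
    unfolding prob_def by (rule ave_pad) (use d d' assms(3) in \<open>auto simp: depends_below_def\<close>)
  also have "\<dots> = ave T 0 (\<lambda>y. 1 / b ^ k * of_bool (P y)) (\<lambda>_. 0)"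
    unfolding ave_add
  proof (rule ave_cong)
    fix y assume y: "y \<in> fibre T 0 (\<lambda>_. 0)"
    have "ave k (0 + T) (\<lambda>x. of_bool (blk k x T = w \<and> P x)) y
        = ave k T (\<lambda>x. of_bool (P y) * of_bool (blk k x T = w)) y"
      unfolding add_0
    proof (rule ave_cong)
      fix z assume "z \<in> fibre k T y"
      then have "P z = P y" by (intro depD[OF assms(2)]) (auto simp: fibre_def)
      then show "of_bool (blk k z T = w \<and> P z) = of_bool (P y) * (of_bool (blk k z T = w) :: real)"
        by auto
    qed
    also have "\<dots> = 1 / b ^ k * of_bool (P y)"
      unfolding ave_scale using ave_blk_eq[OF fibre0_less[OF y] assms(1)] by simp
    finally show "ave k (0 + T) (\<lambda>x. of_bool (blk k x T = w \<and> P x)) y = 1 / b ^ k * of_bool (P y)" .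
  qed
  also have "\<dots> = 1 / b ^ k * ave T 0 (\<lambda>y. of_bool (P y)) (\<lambda>_. 0)"
    by (rule ave_scale)
  also have "ave T 0 (\<lambda>y. of_bool (P y)) (\<lambda>_. 0) = prob H P"
    unfolding prob_def by (rule ave_pad[symmetric]) (use assms in \<open>auto simp: depends_below_def\<close>)
  finally show ?thesis .
qed

lemma prob_blk_word:
  assumes "w < b ^ k" "j + k \<le> H"
  shows "prob H (\<lambda>x. blk k x j = w) = 1 / b ^ k"
  using prob_blk_word_indep[OF assms(1) _ assms(2), of "\<lambda>_. True"]
  by (simp add: prob_def ave_const depends_below_def)

text \<open>The two blocks may overlap: the symbols of the later one are still guessed, one after the other,
  by the corresponding symbols of the earlier one.\<close>

lemma prob_blk_eq:
  assumes "i < j" "j + k \<le> H"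
  shows "prob H (\<lambda>x. blk k x i = blk k x j) = 1 / b ^ k"
proof -
  \<comment> \<open>The guess must use strictly earlier symbols at every position, also at \<open>0\<close>; hence the default value.\<close>
  let ?\<phi> = "\<lambda>(x :: nat \<Rightarrow> nat) t. if j \<le> t then x (t - (j - i)) else 0"
  have d: "depends_below (j + k) (\<lambda>x. blk k x i = blk k x j)"
    unfolding depends_below_def using assms(1) by (intro allI impI arg_cong2[of _ _ _ _ "(=)"] blk_cong) auto
  have "prob H (\<lambda>x. blk k x i = blk k x j)
      = ave (j + k) 0 (\<lambda>x. of_bool (blk k x i = blk k x j)) (\<lambda>_. 0)"
    unfolding prob_def by (rule ave_pad) (use d assms in \<open>auto simp: depends_below_def\<close>)
  also have "\<dots> = ave j 0 (\<lambda>y. 1 / b ^ k) (\<lambda>_. 0)"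
    unfolding ave_add
  proof (rule ave_cong)
    fix y assume y: "y \<in> fibre j 0 (\<lambda>_. 0)"
    have "ave k (0 + j) (\<lambda>x. of_bool (blk k x i = blk k x j)) y
        = ave k j (\<lambda>x. of_bool (\<forall>t\<in>{j..<j + k}. x t = ?\<phi> x t)) y"
      unfolding add_0
    proof (rule ave_cong)
      fix z assume "z \<in> fibre k j y"
      then have z: "z t < b" for t
        using fibre0_less[OF y, of t] by (cases "t \<in> {j..<j + k}") (auto simp: fibre_def)
      have "(\<forall>t\<in>{j..<j + k}. z t = z (t - (j - i))) \<longleftrightarrow> (\<forall>t<k. z (i + t) = z (j + t))"
      proof safe
        fix t assume "\<forall>t\<in>{j..<j + k}. z t = z (t - (j - i))" "t < k"
        then have "z (j + t) = z (j + t - (j - i))" by auto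
        also have "j + t - (j - i) = i + t" using assms(1) by simp
        finally show "z (i + t) = z (j + t)" by simp
      next
        fix t assume *: "\<forall>t<k. z (i + t) = z (j + t)" and t: "t \<in> {j..<j + k}"
        have eqs: "j + (t - j) = t" "i + (t - j) = t - (j - i)" "t - j < k" using t assms(1) by auto
        then have "z (i + (t - j)) = z (j + (t - j))" using * by blast
        then show "z t = z (t - (j - i))" unfolding eqs(1,2) by (rule sym)
      qed
      moreover have "(\<forall>t\<in>{j..<j + k}. z t = z (t - (j - i))) \<longleftrightarrow> (\<forall>t\<in>{j..<j + k}. z t = ?\<phi> z t)"
        by (intro ball_cong refl) simp
      moreover have "blk k z i = blk k z j \<longleftrightarrow> (\<forall>t<k. z (i + t) = z (j + t))"
        by (rule blk_eq_iff) (rule z)+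
      ultimately show "of_bool (blk k z i = blk k z j)
          = (of_bool (\<forall>t\<in>{j..<j + k}. z t = ?\<phi> z t) :: real)"
        by (intro arg_cong[of _ _ of_bool]) blast
    qed
    also have "\<dots> = 1 / b ^ k"
    proof (rule ave_guess)
      show "y t < b" for t by (rule fibre0_less[OF y])
      show "?\<phi> x t = ?\<phi> z t" if "\<And>s. s < t \<Longrightarrow> x s = z s" for x z t
        using that assms(1) by simp
      show "?\<phi> x t < b" if "\<And>s. x s < b" for x t
        using that b_pos by simp
    qed
    finally show "ave k (0 + j) (\<lambda>x. of_bool (blk k x i = blk k x j)) y = 1 / b ^ k" .
  qed
  finally show ?thesis by (simp add: ave_const)
qed

text \<open>The event can differ between \<open>T'\<close> and \<open>T\<close> only if the word occurs at a position in between.\<close>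

lemma prob_window:
  assumes "T' \<le> T"
  shows "\<bar>prob H (\<lambda>x. Q x \<and> hits k T x w = i) - prob H (\<lambda>x. Q x \<and> hits k T' x w = i)\<bar>
    \<le> (\<Sum>j\<in>{T'..<T}. prob H (\<lambda>x. Q x \<and> blk k x j = w))"
proof -
  have le: "\<bar>of_bool (Q x \<and> hits k T x w = i) - of_bool (Q x \<and> hits k T' x w = i)\<bar>
      \<le> (\<Sum>j\<in>{T'..<T}. of_bool (Q x \<and> blk k x j = w) :: real)" for x
  proof (cases "\<exists>j\<in>{T'..<T}. Q x \<and> blk k x j = w")
    case True
    then obtain j where "j \<in> {T'..<T}" "Q x \<and> blk k x j = w" by blast
    then have "1 \<le> (\<Sum>j\<in>{T'..<T}. of_bool (Q x \<and> blk k x j = w) :: real)"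
      using member_le_sum[of j "{T'..<T}" "\<lambda>j. of_bool (Q x \<and> blk k x j = w) :: real"] by simp
    moreover have "\<bar>of_bool P - of_bool P' :: real\<bar> \<le> 1" for P P' by simp
    ultimately show ?thesis by (meson order.trans)
  next
    case False
    then have "Q x \<Longrightarrow> hits k T x w = hits k T' x w"
      unfolding hits_mono_diff[OF assms] by simp
    then have "(Q x \<and> hits k T x w = i) = (Q x \<and> hits k T' x w = i)" by auto
    then show ?thesis by (simp add: sum_nonneg)
  qed
  show ?thesis
    unfolding prob_def ave_minus[symmetric] ave_sum[symmetric]
    by (rule order.trans[OF ave_abs ave_mono]) (rule le)
qed

lemma sum_prob_word_le:
  "(\<Sum>w<b ^ k. prob H (\<lambda>x. f x = w \<and> g x = w)) \<le> prob H (\<lambda>x. g x = f x)"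
  unfolding prob_def ave_sum[symmetric]
proof (rule ave_mono)
  fix y
  have "(\<Sum>w<b ^ k. of_bool (f y = w \<and> g y = w)) \<le> (\<Sum>w<b ^ k. of_bool (w = f y) * of_bool (g y = f y) :: real)"
    by (rule sum_mono) auto
  also have "\<dots> = (\<Sum>w<b ^ k. of_bool (w = f y)) * (of_bool (g y = f y) :: real)"
    by (rule sum_distrib_right[symmetric])
  also have "(\<Sum>w<b ^ k. of_bool (w = f y) :: real) \<le> 1"
    by (simp add: of_bool_def)
  finally show "(\<Sum>w<b ^ k. of_bool (f y = w \<and> g y = w)) \<le> (of_bool (g y = f y) :: real)"
    by (simp add: mult_right_mono)
qed

lemma mean_prob:
  assumes "T + k \<le> Suc H"
  shows "mean k T i = 1 / b ^ k * (\<Sum>w<b ^ k. prob H (\<lambda>x. hits k T x w = i))"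
proof -
  have "freq k T i = (\<lambda>x. 1 / b ^ k * (\<Sum>w<b ^ k. of_bool (hits k T x w = i)))"
    by (intro ext) (simp add: freq_def)
  then show ?thesis
    unfolding mean_eq[OF assms, of i "\<lambda>_. 0"] prob_def by (simp only: ave_scale ave_sum)
qed

text \<open>The occurrence of \<open>w\<close> at \<open>T\<close> is almost independent of the number of earlier occurrences. It is
  exactly independent of the number of occurrences among the first \<open>T - k\<close> positions, which do
  not overlap the block at \<open>T\<close>. Passing from \<open>T\<close> to \<open>T - k\<close> costs the probability of an occurrence
  at one of \<open>k\<close> positions: summed over \<open>w\<close>, it is at most \<open>k p\<close> both when \<open>w\<close> is also required at
  \<open>T\<close>, where it is the probability of two equal blocks, and when this requirement is replaced by
  the factor \<open>p\<close>.\<close>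

lemma hit_defect:
  "\<bar>\<Sum>w<b ^ k. prob (T + k) (\<lambda>x. blk k x T = w \<and> hits k T x w = i)
      - 1 / b ^ k * prob (T + k) (\<lambda>x. hits k T x w = i)\<bar> \<le> 2 * k * (1 / b ^ k)"
proof -
  define p :: real where "p = 1 / b ^ k"
  \<comment> \<open>The positions that may overlap the block at \<open>T\<close>.\<close>
  let ?W = "{T - k..<T}"
  let ?P = "prob (T + k)"
  let ?pair = "\<lambda>w. \<Sum>j\<in>?W. ?P (\<lambda>x. blk k x T = w \<and> blk k x j = w)"
  have p: "0 \<le> p" "b ^ k * p = 1" using b_pos by (auto simp: p_def)
  have cardW: "real (card ?W) \<le> k" by simp
  have one: "\<bar>?P (\<lambda>x. blk k x T = w \<and> hits k T x w = i) - p * ?P (\<lambda>x. hits k T x w = i)\<bar>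
      \<le> ?pair w + p * (k * p)" if w: "w < b ^ k" for w
  proof -
    have 1: "\<bar>?P (\<lambda>x. blk k x T = w \<and> hits k T x w = i)
        - ?P (\<lambda>x. blk k x T = w \<and> hits k (T - k) x w = i)\<bar> \<le> ?pair w"
      by (rule prob_window) simp
    have dep: "depends_below T (\<lambda>x. hits k (T - k) x w = i)"
    proof (cases "k \<le> T")
      case True
      then have "depends_below T (\<lambda>x. hits k (T - k) x w)" by (intro dep_hits) simp
      then show ?thesis unfolding depends_below_def by metis
    next
      case False
      then show ?thesis by (simp add: depends_below_def hits_def)
    qed
    have 2: "?P (\<lambda>x. blk k x T = w \<and> hits k (T - k) x w = i) = p * ?P (\<lambda>x. hits k (T - k) x w = i)"
      unfolding p_def by (rule prob_blk_word_indep[OF w dep]) simp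
    have "\<bar>?P (\<lambda>x. True \<and> hits k T x w = i) - ?P (\<lambda>x. True \<and> hits k (T - k) x w = i)\<bar>
        \<le> (\<Sum>j\<in>?W. ?P (\<lambda>x. True \<and> blk k x j = w))"
      by (rule prob_window) simp
    also have "\<dots> = (\<Sum>j\<in>?W. p)"
      by (intro sum.cong refl) (simp add: p_def prob_blk_word[OF w])
    also have "\<dots> \<le> k * p" using cardW p(1) by (simp add: mult_right_mono)
    finally have 3: "\<bar>p * ?P (\<lambda>x. hits k T x w = i) - p * ?P (\<lambda>x. hits k (T - k) x w = i)\<bar> \<le> p * (k * p)"
      using p(1) by (simp add: abs_mult mult_left_mono flip: right_diff_distrib)
    show ?thesis using 1 3 unfolding 2 by linarith
  qed
  have "(\<Sum>w<b ^ k. ?pair w) = (\<Sum>j\<in>?W. \<Sum>w<b ^ k. ?P (\<lambda>x. blk k x T = w \<and> blk k x j = w))"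
    by (rule sum.swap)
  also have "\<dots> \<le> (\<Sum>j\<in>?W. p)"
  proof (rule sum_mono)
    fix j assume "j \<in> ?W"
    then have "?P (\<lambda>x. blk k x j = blk k x T) = p"
      unfolding p_def by (intro prob_blk_eq) auto
    then show "(\<Sum>w<b ^ k. ?P (\<lambda>x. blk k x T = w \<and> blk k x j = w)) \<le> p"
      using sum_prob_word_le[where k = k and H = "T + k" and f = "\<lambda>x. blk k x T" and g = "\<lambda>x. blk k x j"] by simp
  qed
  also have "\<dots> \<le> k * p" using cardW p(1) by (simp add: mult_right_mono)
  finally have pairs: "(\<Sum>w<b ^ k. ?pair w) \<le> k * p" .
  have "\<bar>\<Sum>w<b ^ k. ?P (\<lambda>x. blk k x T = w \<and> hits k T x w = i) - p * ?P (\<lambda>x. hits k T x w = i)\<bar>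
      \<le> (\<Sum>w<b ^ k. ?pair w + p * (k * p))"
    by (rule order.trans[OF sum_abs sum_mono]) (use one in auto)
  also have "\<dots> = (\<Sum>w<b ^ k. ?pair w) + (b ^ k * p) * (k * p)"
    by (simp add: sum.distrib)
  also have "\<dots> \<le> 2 * k * p" using pairs unfolding p(2) by (simp add: mult.commute)
  finally show ?thesis unfolding p_def by (simp only: of_nat_mult of_nat_numeral)
qed

text \<open>A word has \<open>i\<close> occurrences among the first \<open>T + 1\<close> positions if it has \<open>i\<close> among the first \<open>T\<close> and
  is missed at \<open>T\<close>, or has \<open>i - 1\<close> and is hit at \<open>T\<close>. Up to the defect of independence this is the
  recursion of the binomial distribution.\<close>

lemma mean_Suc:
  fixes k T i :: nat and p :: real
  defines "p \<equiv> 1 / real (b ^ k)"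
  shows "\<bar>mean k (Suc T) i - ((1 - p) * mean k T i + p * (if i = 0 then 0 else mean k T (i - 1)))\<bar>
    \<le> 4 * k * p\<^sup>2"
proof -
  let ?P = "prob (T + k)"
  let ?A = "\<lambda>i w. ?P (\<lambda>x. hits k T x w = i)"
  let ?B = "\<lambda>i w. ?P (\<lambda>x. blk k x T = w \<and> hits k T x w = i)"
  let ?d = "\<lambda>i. \<Sum>w<b ^ k. ?B i w - p * ?A i w"
  let ?prev = "\<lambda>f. if i = 0 then 0 else f (i - 1) :: real"
  have p: "0 \<le> p" by (simp add: p_def)
  have "?P (\<lambda>x. hits k (Suc T) x w = i) = ?A i w - ?B i w + ?prev (\<lambda>i. ?B i w)" for w
  proof (cases "i = 0")
    case True
    have "of_bool (hits k (Suc T) x w = i) = (of_bool (hits k T x w = i)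
        - of_bool (blk k x T = w \<and> hits k T x w = i) :: real)" for x
      using True by (auto simp: hits_def)
    then show ?thesis using True unfolding prob_def by (simp only: ave_minus) simp
  next
    case False
    have "of_bool (hits k (Suc T) x w = i) = (of_bool (hits k T x w = i)
        - of_bool (blk k x T = w \<and> hits k T x w = i)
        + of_bool (blk k x T = w \<and> hits k T x w = i - 1) :: real)" for x
    proof -
      have "hits k (Suc T) x w = hits k T x w + of_bool (blk k x T = w)" by (simp add: hits_def)
      then show ?thesis using False by (cases "blk k x T = w") auto
    qed
    then show ?thesis using False unfolding prob_def by (simp only: ave_minus ave_plus) simp
  qed
  then have "mean k (Suc T) i = p * (\<Sum>w<b ^ k. ?A i w - ?B i w + ?prev (\<lambda>i. ?B i w))"
    by (simp add: mean_prob[of "Suc T" k "T + k"] p_def)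
  also have "\<dots> = p * (\<Sum>w<b ^ k. ?A i w) - p * (\<Sum>w<b ^ k. ?B i w) + p * (\<Sum>w<b ^ k. ?prev (\<lambda>i. ?B i w))"
    by (simp add: sum.distrib sum_subtractf algebra_simps)
  also have "(\<Sum>w<b ^ k. ?prev (\<lambda>i. ?B i w)) = ?prev (\<lambda>i. \<Sum>w<b ^ k. ?B i w)"
    by simp
  finally have M: "mean k (Suc T) i
      = p * (\<Sum>w<b ^ k. ?A i w) - p * (\<Sum>w<b ^ k. ?B i w) + p * ?prev (\<lambda>i. \<Sum>w<b ^ k. ?B i w)" .
  have A: "mean k T i = p * (\<Sum>w<b ^ k. ?A i w)" for i
    unfolding p_def by (rule mean_prob) simp
  have d: "?d i = (\<Sum>w<b ^ k. ?B i w) - mean k T i" for i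
    unfolding A by (simp add: sum_subtractf sum_distrib_left)
  have bound: "\<bar>p * ?d i\<bar> \<le> 2 * k * p\<^sup>2" for i
    using mult_left_mono[OF hit_defect[where k = k and T = T and i = i] p] p
    by (simp add: p_def abs_mult power2_eq_square)
  have "mean k (Suc T) i - ((1 - p) * mean k T i + p * ?prev (mean k T)) = ?prev (\<lambda>i. p * ?d i) - p * ?d i"
    unfolding M d A[of i, symmetric] by (auto simp: algebra_simps)
  moreover have "\<bar>?prev (\<lambda>i. p * ?d i)\<bar> \<le> 2 * k * p\<^sup>2" using bound[of "i - 1"] by auto
  ultimately show ?thesis using bound[of i] by linarith
qed

text \<open>The recursion is a convex combination, so errors add up without being amplified.\<close>

lemma mean_binomial:
  fixes k T i :: nat and p :: real
  defines "p \<equiv> 1 / real (b ^ k)"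
  shows "\<bar>mean k T i - (T choose i) * p ^ i * (1 - p) ^ (T - i)\<bar> \<le> 4 * k * p\<^sup>2 * T"
proof (induction T arbitrary: i)
  case 0
  have "freq k 0 i x = of_bool (i = 0)" for x
    using b_pos by (simp add: freq_def hits_def)
  then have "freq k 0 i = (\<lambda>_. of_bool (i = 0))" by auto
  then show ?case by (cases i) (simp_all add: mean_def ave_const)
next
  case (Suc T)
  define g where "g T i = real (T choose i) * p ^ i * (1 - p) ^ (T - i)" for T i
  have p: "0 \<le> p" "p \<le> 1" using b_pos by (auto simp: p_def divide_le_eq)
  let ?prev = "\<lambda>f. if i = 0 then 0 else f (i - 1) :: real"
  have g: "g (Suc T) i = (1 - p) * g T i + p * ?prev (g T)"
  proof (cases i)
    case (Suc j)
    show ?thesis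
    proof (cases "Suc j \<le> T")
      case True
      then have "T - j = Suc (T - Suc j)" by simp
      then show ?thesis using Suc by (simp add: g_def algebra_simps)
    qed (use Suc in \<open>auto simp: g_def not_le less_Suc_eq_le binomial_eq_0\<close>)
  qed (simp add: g_def)
  have IH: "\<bar>mean k T i - g T i\<bar> \<le> 4 * k * p\<^sup>2 * T" for i
    using Suc.IH[of i] by (simp add: g_def)
  have prev: "\<bar>?prev (mean k T) - ?prev (g T)\<bar> \<le> 4 * k * p\<^sup>2 * T"
    using IH[of "i - 1"] by auto
  have "\<bar>(1 - p) * (mean k T i - g T i) + p * (?prev (mean k T) - ?prev (g T))\<bar>
      \<le> (1 - p) * (4 * k * p\<^sup>2 * T) + p * (4 * k * p\<^sup>2 * T)"
    using p IH[of i] prev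
    by (intro order.trans[OF abs_triangle_ineq] add_mono) (auto simp: abs_mult intro!: mult_left_mono)
  also have "\<dots> = 4 * k * p\<^sup>2 * T" by (simp add: algebra_simps)
  finally have "\<bar>((1 - p) * mean k T i + p * ?prev (mean k T)) - g (Suc T) i\<bar> \<le> 4 * k * p\<^sup>2 * T"
    unfolding g by (simp only: algebra_simps)
  moreover have "4 * k * p\<^sup>2 * Suc T = 4 * k * p\<^sup>2 * T + 4 * k * p\<^sup>2"
    by (simp add: algebra_simps)
  ultimately show ?case
    using mean_Suc[of k T i] unfolding p_def[symmetric] g_def[symmetric] by linarith
qed

lemma mean_tendsto_Poisson:
  assumes "(\<lambda>k. T k / b ^ k) \<longlonglongrightarrow> lam"
  shows "(\<lambda>k. mean k (T k) i) \<longlonglongrightarrow> exp (- lam) * lam ^ i / fact i"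
proof -
  \<comment> \<open>Level \<open>0\<close>, where \<open>p = 1\<close>, is skipped by the shift of the index.\<close>
  define p where "p k = 1 / real (b ^ Suc k)" for k
  let ?T = "\<lambda>k. T (Suc k)"
  let ?g = "\<lambda>k. (?T k choose i) * p k ^ i * (1 - p k) ^ (?T k - i)"
  have T: "(\<lambda>k. ?T k * p k) \<longlonglongrightarrow> lam"
    using LIMSEQ_Suc[OF assms] by (simp add: p_def)
  have p_eq: "p k = (1 / b) ^ Suc k" for k by (simp add: p_def power_divide)
  have "norm (1 / real b) < 1" using b_pos by simp
  then have p0: "p \<longlonglongrightarrow> 0" and kp0: "(\<lambda>k. Suc k * p k) \<longlonglongrightarrow> 0"
    unfolding p_eq
    using LIMSEQ_Suc[OF LIMSEQ_power_zero] LIMSEQ_Suc[OF powser_times_n_limit_0] by blast+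
  have "?g \<longlonglongrightarrow> exp (- lam) * lam ^ i / fact i"
  proof (rule binomial_tendsto_Poisson[OF p0 _ _ T])
    show "0 < p k" for k using b_pos by (simp add: p_def)
    have "1 < real b ^ Suc k" for k using b_pos by (intro one_less_power) auto
    then show "p k < 1" for k by (simp add: p_def divide_less_eq)
  qed
  moreover have "(\<lambda>k. mean (Suc k) (?T k) i - ?g k) \<longlonglongrightarrow> 0"
  proof (rule Lim_null_comparison)
    show "\<forall>\<^sub>F k in sequentially. norm (mean (Suc k) (?T k) i - ?g k) \<le> 4 * (Suc k * p k) * (?T k * p k)"
      using mean_binomial[of "Suc _" "T (Suc _)" i]
      by (intro always_eventually allI) (simp add: p_def power2_eq_square mult_ac del: power_Suc)
    show "(\<lambda>k. 4 * (Suc k * p k) * (?T k * p k)) \<longlonglongrightarrow> 0"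
      using tendsto_mult[OF tendsto_mult[OF tendsto_const kp0] T, of 4] by simp
  qed
  ultimately have "(\<lambda>k. mean (Suc k) (?T k) i) \<longlonglongrightarrow> exp (- lam) * lam ^ i / fact i"
    by (rule Lim_transform)
  then show ?thesis by (rule LIMSEQ_imp_Suc)
qed

end

section \<open>Greedy choice of symbols\<close>

context digits
begin

text \<open>The ratios \<open>grid k h / b ^ k\<close> are about \<open>h / k\<close>. For \<open>h \<le> k * k\<close> they range up to \<open>k\<close> with step
  \<open>1 / k\<close>, so every positive real parameter is eventually approximated.\<close>

definition grid :: "nat \<Rightarrow> nat \<Rightarrow> nat" where
  "grid k h = h * b ^ k div k"

definition dev :: "nat \<Rightarrow> (nat \<Rightarrow> nat) \<Rightarrow> real" where
  "dev k x = (\<Sum>h<Suc (k * k). \<Sum>i<Suc k. (freq k (grid k h) i x - mean k (grid k h) i)\<^sup>2)"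

definition cost :: "nat \<Rightarrow> (nat \<Rightarrow> nat) \<Rightarrow> real" where
  "cost n x = (\<Sum>k<n. dev k x)"

text \<open>A bound for the number of symbols on which the levels up to \<open>n\<close> depend.\<close>

definition horizon :: "nat \<Rightarrow> nat" where
  "horizon n = n * b ^ n + n"

lemma grid_horizon:
  assumes "h < Suc (k * k)"
  shows "grid k h + k \<le> horizon k"
proof (cases "k = 0")
  case False
  have "grid k h \<le> k * k * b ^ k div k"
    unfolding grid_def using assms by (intro div_le_mono mult_right_mono) auto
  also have "\<dots> = k * b ^ k" using False by (simp add: mult.assoc)
  finally show ?thesis by (simp add: horizon_def)
qed (simp add: grid_def)

lemma horizon_mono: "k \<le> n \<Longrightarrow> horizon k \<le> horizon n"
  unfolding horizon_def using b_pos by (intro add_mono mult_mono power_increasing) auto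

lemma dep_dev: "depends_below (horizon k) (dev k)"
  unfolding depends_below_def
proof (intro allI impI)
  fix x y :: "nat \<Rightarrow> nat" assume xy: "\<forall>t<horizon k. x t = y t"
  have "freq k (grid k h) i x = freq k (grid k h) i y" if "h < Suc (k * k)" for h i
    by (rule depD[OF dep_freq[of _ _ "horizon k"]]) (use xy grid_horizon[OF that] in auto)
  then show "dev k x = dev k y" unfolding dev_def by (intro sum.cong refl) simp
qed

lemma dep_cost: "depends_below (horizon n) (cost n)"
  unfolding depends_below_def cost_def
proof (intro allI impI sum.cong refl)
  fix x y :: "nat \<Rightarrow> nat" and k assume xy: "\<forall>t<horizon n. x t = y t" and k: "k \<in> {..<n}"
  show "dev k x = dev k y"
    by (rule depD[OF dep_dev]) (use xy horizon_mono[of k n] k in auto)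
qed

lemma dev_nonneg: "0 \<le> dev k x"
  unfolding dev_def by (intro sum_nonneg zero_le_power2)

text \<open>A bound for the conditional expectation of \<open>dev k\<close> after \<open>k + 1\<close> symbols: the number of summands
  of \<open>dev k\<close>, times squared bias plus variance, where one symbol changes a frequency by at most
  \<open>2 * k / b ^ k\<close>.\<close>

definition entry :: "nat \<Rightarrow> real" where
  "entry k = (k * k + 1) * ((k + 1) * ((Suc k * (2 * k / b ^ k))\<^sup>2 + horizon k * (2 * k / b ^ k)\<^sup>2))"

lemma ave_dev_le: "ave (horizon k) (Suc k) (dev k) x \<le> entry k"
proof -
  let ?d = "2 * real k / real (b ^ k)" and ?m = "horizon k"
  have one: "ave ?m (Suc k) (\<lambda>y. (freq k (grid k h) i y - mean k (grid k h) i)\<^sup>2) x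
      \<le> (Suc k * ?d)\<^sup>2 + ?m * ?d\<^sup>2" if "h < Suc (k * k)" for h i
  proof -
    let ?F = "freq k (grid k h) i"
    have L: "osc_le ?d ?F" using osc_le_freq[of k "grid k h" i] by simp
    have "mean k (grid k h) i = ave (?m + Suc k) 0 ?F x"
      by (rule mean_eq) (use grid_horizon[OF that] in simp)
    then have "\<bar>ave ?m (Suc k) ?F x - mean k (grid k h) i\<bar> \<le> Suc k * ?d"
      using ave_bias[OF L, of ?m "Suc k" x] by simp
    then have "(ave ?m (Suc k) ?F x - mean k (grid k h) i)\<^sup>2 \<le> (Suc k * ?d)\<^sup>2"
      using abs_le_square_iff by fastforce
    then show ?thesis using ave_square[OF L, of ?m "Suc k" "mean k (grid k h) i" x] by linarith
  qed
  have "ave ?m (Suc k) (dev k) x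
      = (\<Sum>h<Suc (k * k). \<Sum>i<Suc k. ave ?m (Suc k) (\<lambda>y. (freq k (grid k h) i y - mean k (grid k h) i)\<^sup>2) x)"
    unfolding dev_def[abs_def] ave_sum ..
  also have "\<dots> \<le> (\<Sum>h<Suc (k * k). \<Sum>i<Suc k. (Suc k * ?d)\<^sup>2 + ?m * ?d\<^sup>2)"
    by (intro sum_mono one) simp
  also have "\<dots> = entry k" by (simp add: entry_def algebra_simps)
  finally show ?thesis .
qed

lemma entry_nonneg: "0 \<le> entry k"
  by (simp add: entry_def)

text \<open>The entry costs are polynomials in \<open>k\<close> divided by \<open>b ^ k\<close>.\<close>

lemma summable_entry: "summable entry"
proof (rule summable_comparison_test')
  let ?q = "\<lambda>k. (real k * real k + 1) * ((real k + 1) * ((real k + 1)\<^sup>2 * (2 * real k)\<^sup>2 + 2 * real k * (2 * real k)\<^sup>2)) / 2 ^ k"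
  have "?q \<in> O(\<lambda>k. 1 / real k ^ 2)" by real_asymp
  moreover have "summable (\<lambda>k. norm (1 / real k ^ 2))"
    using inverse_power_summable[of 2, where 'a = real] by (simp add: field_simps)
  ultimately show "summable ?q" by (rule summable_comparison_test_bigo[rotated])
  fix k :: nat
  let ?B = "real b ^ k"
  have B: "2 ^ k \<le> ?B" "1 \<le> ?B" "0 < ?B" using b_ge_2 b_pos by (auto intro: power_mono)
  have "(Suc k * (2 * k / ?B))\<^sup>2 = (real k + 1)\<^sup>2 * (2 * real k)\<^sup>2 / ?B / ?B"
    by (simp add: power2_eq_square power_divide algebra_simps)
  also have "\<dots> \<le> (real k + 1)\<^sup>2 * (2 * real k)\<^sup>2 / ?B / 1"
    using B by (intro divide_left_mono) auto
  finally have 1: "(Suc k * (2 * k / ?B))\<^sup>2 \<le> (real k + 1)\<^sup>2 * (2 * real k)\<^sup>2 / ?B" by simp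
  have "horizon k * (2 * k / ?B)\<^sup>2 \<le> (2 * real k * ?B) * (2 * k / ?B)\<^sup>2"
  proof (rule mult_right_mono)
    have "real k * 1 \<le> real k * ?B" using B by (intro mult_left_mono) auto
    then show "real (horizon k) \<le> 2 * real k * ?B" by (simp add: horizon_def)
  qed simp
  also have "\<dots> = 2 * real k * (2 * real k)\<^sup>2 / ?B"
    using B(3) by (simp add: power2_eq_square field_simps)
  finally have 2: "horizon k * (2 * k / ?B)\<^sup>2 \<le> 2 * real k * (2 * real k)\<^sup>2 / ?B" .
  have "entry k \<le> (real k * real k + 1) * ((real k + 1) * ((real k + 1)\<^sup>2 * (2 * real k)\<^sup>2 / ?B
      + 2 * real k * (2 * real k)\<^sup>2 / ?B))"
    using 1 2 unfolding entry_def by (intro mult_mono add_mono) (auto intro!: add_nonneg_nonneg)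
  also have "\<dots> = (real k * real k + 1) * ((real k + 1) * ((real k + 1)\<^sup>2 * (2 * real k)\<^sup>2
      + 2 * real k * (2 * real k)\<^sup>2)) / ?B"
    by (simp only: add_divide_distrib[symmetric] times_divide_eq_right)
  also have "\<dots> \<le> ?q k"
    using B by (intro divide_left_mono mult_nonneg_nonneg add_nonneg_nonneg) auto
  finally show "norm (entry k) \<le> ?q k" using entry_nonneg by simp
qed

text \<open>The potential \<open>ave (horizon n) n (cost n) x\<close> does not grow by the choice of the next symbol and
  grows by at most \<open>entry n\<close> when level \<open>n\<close> enters. Once all symbols on which \<open>cost K\<close> depends are
  fixed, the potential is at least the true value \<open>cost K x\<close>.\<close>

lemma greedy_cost_bounded:
  assumes greedy: "\<And>n. ave (horizon n) (Suc n) (cost n) x \<le> ave (Suc (horizon n)) n (cost n) x"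
  shows "cost K x \<le> suminf entry"
proof -
  have R: "ave (horizon n) n (cost n) x \<le> (\<Sum>k<n. entry k)" for n
  proof (induction n)
    case 0
    have "cost 0 = (\<lambda>_. 0)" by (simp add: cost_def fun_eq_iff)
    then show ?case by (simp add: ave_const)
  next
    case (Suc n)
    have hor: "horizon n \<le> horizon (Suc n)" by (rule horizon_mono) simp
    have "cost (Suc n) = (\<lambda>y. cost n y + dev n y)" by (simp add: cost_def fun_eq_iff)
    then have "ave (horizon (Suc n)) (Suc n) (cost (Suc n)) x
        = ave (horizon (Suc n)) (Suc n) (cost n) x + ave (horizon (Suc n)) (Suc n) (dev n) x"
      by (simp only: ave_plus)
    also have "\<dots> = ave (horizon n) (Suc n) (cost n) x + ave (horizon n) (Suc n) (dev n) x"
      by (intro arg_cong2[of _ _ _ _ "(+)"] ave_pad hor dep_mono[OF dep_cost] dep_mono[OF dep_dev]) auto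
    also have "\<dots> \<le> ave (Suc (horizon n)) n (cost n) x + entry n"
      by (intro add_mono greedy ave_dev_le)
    also have "ave (Suc (horizon n)) n (cost n) x = ave (horizon n) n (cost n) x"
      by (intro ave_pad dep_mono[OF dep_cost]) auto
    finally show ?case using Suc by simp
  qed
  \<comment> \<open>At this time all levels below \<open>K\<close> have entered and all their symbols are fixed.\<close>
  let ?N = "horizon K"
  have K: "K \<le> ?N" by (simp add: horizon_def)
  have "cost K x = ave (horizon ?N) ?N (cost K) x"
    using ave_pad[of ?N 0 "cost K" "horizon ?N" x] dep_cost by simp
  also have "\<dots> \<le> ave (horizon ?N) ?N (cost ?N) x"
    unfolding cost_def using K dev_nonneg by (intro ave_mono sum_mono2) auto
  also have "\<dots> \<le> (\<Sum>k<?N. entry k)" by (rule R)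
  also have "\<dots> \<le> suminf entry"
    by (intro sum_le_suminf summable_entry entry_nonneg) auto
  finally show ?thesis .
qed

definition poisson_digits :: "(nat \<Rightarrow> nat) \<Rightarrow> bool" where
  "poisson_digits x \<longleftrightarrow> (\<forall>lam::real. 0 < lam \<longrightarrow> (\<forall>i.
     (\<lambda>k. freq k (nat \<lfloor>lam * b ^ k\<rfloor>) i x) \<longlonglongrightarrow> exp (- lam) * lam ^ i / fact i))"

lemma inverse_power_b_tendsto: "(\<lambda>k. 1 / real b ^ k) \<longlonglongrightarrow> 0" "(\<lambda>k. real k / real b ^ k) \<longlonglongrightarrow> 0"
proof -
  have "norm (1 / real b) < 1" using b_pos by simp
  from LIMSEQ_power_zero[OF this] powser_times_n_limit_0[OF this]
  show "(\<lambda>k. 1 / real b ^ k) \<longlonglongrightarrow> 0" "(\<lambda>k. real k / real b ^ k) \<longlonglongrightarrow> 0"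
    by (simp_all add: power_divide)
qed

text \<open>For given \<open>lam\<close> use the grid point just below \<open>lam * b ^ k\<close>. The frequency there is close to its
  mean, the mean converges to the Poisson probability by \<open>mean_tendsto_Poisson\<close>, and the window
  between the grid point and \<open>lam * b ^ k\<close> contains only about \<open>b ^ k / k\<close> positions.\<close>

lemma dev_tendsto_imp_poisson:
  assumes "(\<lambda>k. dev k x) \<longlonglongrightarrow> 0"
  shows "poisson_digits x"
  unfolding poisson_digits_def
proof (intro allI impI)
  fix lam :: real and i :: nat
  assume lam: "0 < lam"
  define h where "h k = nat \<lfloor>lam * k\<rfloor>" for k :: nat
  define T where "T k = nat \<lfloor>lam * b ^ k\<rfloor>" for k
  let ?G = "\<lambda>k. grid k (h k)"
  let ?e = "\<lambda>k. 1 / real k + 1 / real b ^ k"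
  have e: "?e \<longlonglongrightarrow> 0"
    using tendsto_add[OF lim_1_over_n inverse_power_b_tendsto(1)] by simp
  have G: "?G k \<le> T k" "lam * b ^ k - ?G k \<le> b ^ k / k + 1" "?G k \<le> lam * b ^ k" "T k \<le> lam * b ^ k"
    if k: "0 < k" for k
  proof -
    have "0 \<le> lam * k" using lam by simp
    then have h: "h k \<le> lam * k" "lam * k - 1 \<le> h k" unfolding h_def by linarith+
    have floor: "\<lfloor>real (h k * b ^ k) / real k\<rfloor> = int (?G k)"
      unfolding grid_def by (rule floor_divide_of_nat_eq)
    then have "real (?G k) \<le> real (h k * b ^ k) / k" by linarith
    then have "real (?G k) \<le> real (h k) * b ^ k / k" by simp
    also have "\<dots> \<le> lam * k * b ^ k / k"
      by (intro divide_right_mono mult_right_mono h(1)) simp_all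
    finally show le: "real (?G k) \<le> lam * b ^ k" using k by simp
    then show "?G k \<le> T k" unfolding T_def by linarith
    show "T k \<le> lam * b ^ k" unfolding T_def using lam by simp
    have "(lam * k - 1) * b ^ k / k - 1 \<le> real (h k) * b ^ k / k - 1"
      by (intro diff_right_mono divide_right_mono mult_right_mono h(2)) simp_all
    also have "\<dots> \<le> ?G k"
    proof -
      have "real (h k * b ^ k) / k - 1 \<le> ?G k" using floor by linarith
      then show ?thesis by simp
    qed
    finally show "lam * b ^ k - ?G k \<le> b ^ k / k + 1" using k by (simp add: field_simps)
  qed
  have "(\<lambda>k. ?G k / b ^ k - lam) \<longlonglongrightarrow> 0"
  proof (rule Lim_null_comparison[OF _ e], rule eventually_sequentiallyI[of 1])
    fix k :: nat assume "1 \<le> k"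
    then have "\<bar>?G k - lam * b ^ k\<bar> \<le> b ^ k / k + 1" using G[of k] by (simp add: abs_le_iff)
    then have "\<bar>?G k - lam * b ^ k\<bar> / b ^ k \<le> (b ^ k / k + 1) / b ^ k"
      by (rule divide_right_mono) simp
    moreover have "?G k / b ^ k - lam = (?G k - lam * b ^ k) / b ^ k"
      using b_pos by (simp add: field_simps)
    ultimately show "norm (?G k / b ^ k - lam) \<le> ?e k"
      using b_pos by (simp add: add_divide_distrib)
  qed
  then have "(\<lambda>k. ?G k / b ^ k) \<longlonglongrightarrow> lam" by (rule LIM_zero_cancel)
  then have "(\<lambda>k. mean k (?G k) i) \<longlonglongrightarrow> exp (- lam) * lam ^ i / fact i"
    by (rule mean_tendsto_Poisson)
  moreover have "(\<lambda>k. freq k (?G k) i x - mean k (?G k) i) \<longlonglongrightarrow> 0"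
  proof (rule Lim_null_comparison)
    show "(\<lambda>k. sqrt (dev k x)) \<longlonglongrightarrow> 0" using tendsto_real_sqrt[OF assms] by simp
    show "\<forall>\<^sub>F k in sequentially. norm (freq k (?G k) i x - mean k (?G k) i) \<le> sqrt (dev k x)"
    proof (rule eventually_sequentiallyI[of "max i (nat \<lceil>lam\<rceil>)"])
      fix k assume k: "max i (nat \<lceil>lam\<rceil>) \<le> k"
      then have "lam \<le> k" by linarith
      then have "lam * k \<le> real k * real k" by (rule mult_right_mono) simp
      then have "lam * k \<le> k * k" by simp
      then have h: "h k < Suc (k * k)" unfolding h_def using lam by linarith
      have "(freq k (?G k) i x - mean k (?G k) i)\<^sup>2
          \<le> (\<Sum>i<Suc k. (freq k (?G k) i x - mean k (?G k) i)\<^sup>2)"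
        using k by (intro member_le_sum) auto
      also have "\<dots> \<le> dev k x"
        unfolding dev_def using h
        by (intro member_le_sum[of "h k" _ "\<lambda>h. \<Sum>i<Suc k. (freq k (grid k h) i x - mean k (grid k h) i)\<^sup>2"])
          (auto intro: sum_nonneg simp del: sum.lessThan_Suc)
      finally show "norm (freq k (?G k) i x - mean k (?G k) i) \<le> sqrt (dev k x)"
        by (simp add: real_le_rsqrt)
    qed
  qed
  ultimately have "(\<lambda>k. freq k (?G k) i x) \<longlonglongrightarrow> exp (- lam) * lam ^ i / fact i"
    by (rule Lim_transform)
  moreover have "(\<lambda>k. freq k (T k) i x - freq k (?G k) i x) \<longlonglongrightarrow> 0"
  proof (rule Lim_null_comparison)
    show "(\<lambda>k. 2 * ?e k) \<longlonglongrightarrow> 0" using tendsto_mult[OF tendsto_const e, of 2] by simp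
    show "\<forall>\<^sub>F k in sequentially. norm (freq k (T k) i x - freq k (?G k) i x) \<le> 2 * ?e k"
    proof (rule eventually_sequentiallyI[of 1])
      fix k :: nat assume k: "1 \<le> k"
      have "\<bar>freq k (T k) i x - freq k (?G k) i x\<bar> \<le> 2 * (real (T k) - real (?G k)) / b ^ k"
        using freq_window[of "?G k" "T k" k i x] G(1)[of k] k by (simp add: abs_minus_commute of_nat_diff)
      also have "\<dots> \<le> 2 * (b ^ k / k + 1) / b ^ k"
        using G(2,4)[of k] k by (intro divide_right_mono) auto
      also have "\<dots> = 2 * ?e k" using k b_pos by (simp add: field_simps)
      finally show "norm (freq k (T k) i x - freq k (?G k) i x) \<le> 2 * ?e k" by simp
    qed
  qed
  ultimately show "(\<lambda>k. freq k (nat \<lfloor>lam * b ^ k\<rfloor>) i x) \<longlonglongrightarrow> exp (- lam) * lam ^ i / fact i"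
    unfolding T_def by (rule Lim_transform)
qed

lemma greedy_imp_poisson:
  assumes "\<And>n. ave (horizon n) (Suc n) (cost n) x \<le> ave (Suc (horizon n)) n (cost n) x"
  shows "poisson_digits x"
proof (rule dev_tendsto_imp_poisson, rule summable_LIMSEQ_zero, rule summableI_nonneg_bounded)
  show "(\<Sum>k<n. dev k x) \<le> suminf entry" for n
    using greedy_cost_bounded[OF assms, of n] by (simp add: cost_def)
qed (rule dev_nonneg)

text \<open>One altered symbol moves the frequencies by at most \<open>2 * k / b ^ k\<close>.\<close>

lemma poisson_digits_upd:
  assumes "poisson_digits x"
  shows "poisson_digits (x(N := a))"
  unfolding poisson_digits_def
proof (intro allI impI)
  fix lam :: real and i :: nat
  assume "0 < lam"
  let ?f = "\<lambda>x k. freq k (nat \<lfloor>lam * b ^ k\<rfloor>) i x"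
  have "?f x \<longlonglongrightarrow> exp (- lam) * lam ^ i / fact i"
    using assms \<open>0 < lam\<close> by (simp add: poisson_digits_def)
  moreover have "(\<lambda>k. ?f (x(N := a)) k - ?f x k) \<longlonglongrightarrow> 0"
  proof (rule Lim_null_comparison)
    show "\<forall>\<^sub>F k in sequentially. norm (?f (x(N := a)) k - ?f x k) \<le> 2 * (k / b ^ k)"
      using freq_upd by (intro always_eventually) (simp del: fun_upd_apply)
    show "(\<lambda>k. 2 * (k / b ^ k)) \<longlonglongrightarrow> 0"
      using tendsto_mult[OF tendsto_const inverse_power_b_tendsto(2), of 2] by simp
  qed
  ultimately show "?f (x(N := a)) \<longlonglongrightarrow> exp (- lam) * lam ^ i / fact i"
    by (rule Lim_transform)
qed

end

section \<open>The greedy choice in integer arithmetic\<close>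

context digits
begin

lemma dig_append:
  assumes "c < b ^ n"
  shows "dig (c + b ^ n * v) t = (if t < n then dig c t else dig v (t - n))"
proof (cases "t < n")
  case True
  then have "b ^ n = b ^ (t + 1 + (n - Suc t))" by simp
  then have eq: "c + b ^ n * v = c + b ^ t * (b * (b ^ (n - Suc t) * v))"
    by (simp only: power_add power_one_right mult.assoc)
  have "dig (c + b ^ n * v) t = dig c t"
    unfolding eq dig_def using b_pos by simp
  then show ?thesis using True by simp
next
  case False
  then have eq: "b ^ t = b ^ n * b ^ (t - n)" by (simp flip: power_add)
  have "(c + b ^ n * v) div b ^ n = v" using assms b_pos by simp
  then have "dig (c + b ^ n * v) t = dig v (t - n)"
    unfolding dig_def eq div_mult2_eq by simp
  then show ?thesis using False by simp
qed

lemma dig_less_power: "c < b ^ n \<Longrightarrow> n \<le> t \<Longrightarrow> dig c t = 0"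
  using dig_append[of c n 0 t] by (simp add: dig_def)

lemma dig_upd:
  assumes "c < b ^ n" "a < b"
  shows "(dig c)(n := a) = dig (c + b ^ n * a)"
proof
  fix t
  have "dig a (t - n) = (if t = n then a else 0)" if "n \<le> t"
    using that assms(2) dig_less_power[of a 1 "t - n"] by (auto simp: dig_def[of a 0])
  then show "((dig c)(n := a)) t = dig (c + b ^ n * a) t"
    using dig_append[OF assms(1), of a t] dig_less_power[OF assms(1), of t] by auto
qed

lemma append_less: "c < b ^ n \<Longrightarrow> v < b ^ m \<Longrightarrow> c + b ^ n * v < b ^ (n + m)"
proof -
  assume "c < b ^ n" "v < b ^ m"
  then have "c + b ^ n * v < b ^ n * Suc v" by simp
  also have "\<dots> \<le> b ^ n * b ^ m" using \<open>v < b ^ m\<close> by (intro mult_left_mono) auto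
  finally show ?thesis by (simp add: power_add)
qed

text \<open>A prefix is coded by a number \<open>c < b ^ n\<close>; its continuations by \<open>m\<close> symbols are the numbers
  \<open>c + b ^ n * v\<close> with \<open>v < b ^ m\<close>. So conditional expectations become finite sums.\<close>

lemma ave_dig:
  assumes "c < b ^ n"
  shows "ave m n F (dig c) = (\<Sum>v<b ^ m. F (dig (c + b ^ n * v))) / b ^ m"
  using assms
proof (induction m arbitrary: n c)
  case (Suc m)
  have "ave m (Suc n) F ((dig c)(n := a)) = (\<Sum>v<b ^ m. F (dig (c + b ^ n * (a + b * v)))) / b ^ m"
    if "a < b" for a
    unfolding dig_upd[OF Suc.prems that]
    using Suc.IH[of "c + b ^ n * a" "Suc n"] append_less[of c n a 1] Suc.prems that
    by (simp add: algebra_simps)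
  then have "ave (Suc m) n F (dig c)
      = (\<Sum>a<b. (\<Sum>v<b ^ m. F (dig (c + b ^ n * (a + b * v)))) / b ^ m) / b"
    by (simp del: fun_upd_apply)
  also have "\<dots> = (\<Sum>a<b. \<Sum>v<b ^ m. F (dig (c + b ^ n * (a + b * v)))) / b ^ Suc m"
    by (simp add: sum_divide_distrib[symmetric] mult.commute)
  also have "(\<Sum>a<b. \<Sum>v<b ^ m. F (dig (c + b ^ n * (a + b * v))))
      = (\<Sum>v<b ^ m. \<Sum>a<b. F (dig (c + b ^ n * (a + v * b))))"
    by (subst sum.swap) (simp add: mult.commute)
  also have "\<dots> = (\<Sum>v<b ^ Suc m. F (dig (c + b ^ n * v)))"
  proof -
    have "(\<Sum>a<b. F (dig (c + b ^ n * (a + v * b))))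
        = sum (\<lambda>v. F (dig (c + b ^ n * v))) {v * b..<v * b + b}" for v
      using sum.shift_bounds_nat_ivl[of "\<lambda>v. F (dig (c + b ^ n * v))" 0 "v * b" b]
      by (simp add: atLeast0LessThan add.commute)
    then show ?thesis
      using sum.nat_group[of "\<lambda>v. F (dig (c + b ^ n * v))" b "b ^ m"] by (simp add: mult.commute)
  qed
  finally show ?case .
qed simp

definition word_hits :: "nat \<Rightarrow> nat \<Rightarrow> nat \<Rightarrow> nat \<Rightarrow> nat" where
  "word_hits u k T w = (\<Sum>j<T. of_bool (u div b ^ j mod b ^ k = w))"

definition freq_num :: "nat \<Rightarrow> nat \<Rightarrow> nat \<Rightarrow> nat \<Rightarrow> nat" where
  "freq_num u k T i = (\<Sum>w<b ^ k. of_bool (word_hits u k T w = i))"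

definition mean_num :: "nat \<Rightarrow> nat \<Rightarrow> nat \<Rightarrow> nat \<Rightarrow> nat" where
  "mean_num H k T i = (\<Sum>u<b ^ H. freq_num u k T i)"

definition sq_diff :: "nat \<Rightarrow> nat \<Rightarrow> nat" where
  "sq_diff p q = ((p - q) + (q - p)) * ((p - q) + (q - p))"

definition dev_num :: "nat \<Rightarrow> nat \<Rightarrow> nat \<Rightarrow> nat" where
  "dev_num H k u = (\<Sum>h<Suc (k * k). \<Sum>i<Suc k.
     sq_diff (b ^ H * freq_num u k (grid k h) i) (mean_num H k (grid k h) i))"

text \<open>The denominator of \<open>dev k\<close> contains \<open>b ^ (2 * k)\<close>. The factor \<open>b ^ (2 * (n - k))\<close> brings the
  levels below \<open>n\<close> to the common denominator of \<open>cost_dig\<close>.\<close>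

definition cost_num :: "nat \<Rightarrow> nat \<Rightarrow> nat \<Rightarrow> nat" where
  "cost_num n H u = (\<Sum>k<n. b ^ (2 * (n - k)) * dev_num H k u)"

text \<open>Up to a factor which depends only on \<open>n\<close>, the expected cost after the prefix \<open>c\<close> of length \<open>n + 1\<close>.\<close>

definition score :: "nat \<Rightarrow> nat \<Rightarrow> nat" where
  "score n c = (\<Sum>v<b ^ horizon n. cost_num n (Suc n + horizon n) (c + b ^ Suc n * v))"

definition good :: "nat \<Rightarrow> nat \<Rightarrow> nat \<Rightarrow> bool" where
  "good n c a \<longleftrightarrow> b * score n (c + b ^ n * a) \<le> (\<Sum>d<b. score n (c + b ^ n * d))"

text \<open>The least good digit, written as the number of positions before it.\<close>

definition pick :: "nat \<Rightarrow> nat \<Rightarrow> nat" where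
  "pick n c = (\<Sum>m<b. of_bool ((\<Sum>a<Suc m. of_bool (good n c a)) = (0 :: nat)))"

text \<open>The number coding the first \<open>n\<close> symbols of the greedy sequence.\<close>

definition code :: "nat \<Rightarrow> nat" where
  "code n = rec_nat 0 (\<lambda>n c. c + b ^ n * pick n c) n"

definition greedy :: "nat \<Rightarrow> nat" where
  "greedy n = pick n (code n)"

lemma freq_dig: "freq k T i (dig u) = freq_num u k T i / b ^ k"
  unfolding freq_def freq_num_def word_hits_def hits_def blk_dig by simp

lemma mean_num:
  assumes "T + k \<le> Suc H"
  shows "mean k T i = mean_num H k T i / (b ^ H * b ^ k)"
proof -
  have "mean k T i = ave H 0 (freq k T i) (dig 0)" by (rule mean_eq[OF assms])
  also have "\<dots> = (\<Sum>u<b ^ H. freq k T i (dig u)) / b ^ H" by (simp add: ave_dig)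
  also have "\<dots> = mean_num H k T i / (b ^ H * b ^ k)"
    by (simp add: freq_dig mean_num_def sum_divide_distrib[symmetric])
  finally show ?thesis .
qed

lemma sq_diff: "real (sq_diff p q) = (real p - real q)\<^sup>2"
proof -
  have "real ((p - q) + (q - p)) = \<bar>real p - real q\<bar>" by linarith
  then show ?thesis unfolding sq_diff_def of_nat_mult by (simp only: power2_abs flip: power2_eq_square)
qed

lemma dev_dig:
  assumes "horizon k \<le> H"
  shows "dev k (dig u) = dev_num H k u / (b ^ (2 * H) * b ^ (2 * k))"
proof -
  have "(freq k (grid k h) i (dig u) - mean k (grid k h) i)\<^sup>2
      = sq_diff (b ^ H * freq_num u k (grid k h) i) (mean_num H k (grid k h) i) / (b ^ (2 * H) * b ^ (2 * k))"
    if "h < Suc (k * k)" for h i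
  proof -
    have "mean k (grid k h) i = mean_num H k (grid k h) i / (b ^ H * b ^ k)"
      by (rule mean_num) (use grid_horizon[OF that] assms in simp)
    moreover have "freq k (grid k h) i (dig u) = b ^ H * freq_num u k (grid k h) i / (b ^ H * b ^ k)"
      using b_pos by (simp add: freq_dig)
    moreover have "real (b ^ (2 * H) * b ^ (2 * k)) = (real (b ^ H * b ^ k))\<^sup>2"
      by (simp add: power_mult_distrib power_mult[symmetric] mult.commute)
    ultimately show ?thesis
      unfolding sq_diff by (simp only: diff_divide_distrib[symmetric] power_divide)
  qed
  then show ?thesis
    unfolding dev_def dev_num_def of_nat_sum sum_divide_distrib by (intro sum.cong refl) auto
qed

lemma cost_dig:
  assumes "horizon n \<le> H"
  shows "cost n (dig u) = cost_num n H u / (b ^ (2 * H) * b ^ (2 * n))"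
proof -
  have "dev k (dig u) = (b ^ (2 * (n - k)) * dev_num H k u) / (b ^ (2 * H) * b ^ (2 * n))"
    if "k < n" for k
  proof -
    have "b ^ (2 * n) = b ^ (2 * (n - k)) * b ^ (2 * k)"
      using that by (simp flip: power_add add: algebra_simps)
    moreover have "horizon k \<le> H" using horizon_mono[of k n] that assms by linarith
    ultimately show ?thesis using b_pos by (simp add: dev_dig[of k H])
  qed
  then show ?thesis
    unfolding cost_def cost_num_def of_nat_sum sum_divide_distrib by (intro sum.cong refl) auto
qed

lemma score:
  assumes "c < b ^ Suc n"
  shows "ave (horizon n) (Suc n) (cost n) (dig c)
    = score n c / (b ^ (2 * (Suc n + horizon n)) * b ^ (2 * n) * b ^ horizon n)"
  unfolding ave_dig[OF assms] score_def
  by (simp add: cost_dig[of n "Suc n + horizon n"] sum_divide_distrib[symmetric] del: power_Suc)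

text \<open>Bounded search with sums only: the inner sum vanishes exactly for the \<open>m\<close> before the first \<open>a\<close> that
  satisfies \<open>P\<close>.\<close>

lemma sum_before_first:
  assumes "a < N" "P a"
  defines "l \<equiv> (\<Sum>m<N. of_bool ((\<Sum>a<Suc m. of_bool (P a)) = (0 :: nat)) :: nat)"
  shows "l < N" "P l"
proof -
  have Least: "P (Least P)" "Least P \<le> a" "\<And>a. a < Least P \<Longrightarrow> \<not> P a"
    using LeastI[of P, OF assms(2)] Least_le[of P, OF assms(2)] not_less_Least by auto
  have "(\<Sum>a<Suc m. of_bool (P a)) = (0 :: nat) \<longleftrightarrow> m < Least P" for m
  proof -
    have "(\<Sum>a<Suc m. of_bool (P a)) = (0 :: nat) \<longleftrightarrow> (\<forall>a<Suc m. \<not> P a)"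
      by (subst sum_eq_0_iff) auto
    also have "\<dots> \<longleftrightarrow> m < Least P"
      using Least by (metis less_Suc_eq_le less_le_trans not_le)
    finally show ?thesis .
  qed
  then have "l = card ({..<N} \<inter> {m. m < Least P})"
    unfolding l_def by (simp only: Groups_Big.sum_of_bool_eq finite_lessThan of_nat_id)
  also have "{..<N} \<inter> {m. m < Least P} = {..<Least P}" using Least(2) assms(1) by auto
  finally have "l = Least P" by simp
  then show "l < N" "P l" using Least(1,2) assms(1) by auto
qed

lemma pick:
  assumes "c < b ^ n"
  shows "pick n c < b"
    and "ave (horizon n) (Suc n) (cost n) (dig (c + b ^ n * pick n c))
      \<le> ave (Suc (horizon n)) n (cost n) (dig c)"
proof -
  define D where "D = real (b ^ (2 * (Suc n + horizon n)) * b ^ (2 * n) * b ^ horizon n)"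
  have D: "0 < D" using b_pos by (simp add: D_def)
  have scale: "real b * s \<le> S \<longleftrightarrow> s / D \<le> S / D / b" for s S
    using D b_pos by (simp add: field_simps)
  have score': "ave (horizon n) (Suc n) (cost n) (dig (c + b ^ n * a)) = score n (c + b ^ n * a) / D"
    if "a < b" for a
    using score[of "c + b ^ n * a" n] append_less[OF assms, of a 1] that by (simp add: D_def)
  have ave: "ave (Suc (horizon n)) n (cost n) (dig c) = (\<Sum>d<b. score n (c + b ^ n * d)) / D / b"
    unfolding of_nat_sum sum_divide_distrib[where r = D]
    by (simp add: dig_upd[OF assms] score' del: fun_upd_apply of_nat_mult of_nat_power)
  have iff: "good n c a \<longleftrightarrow> ave (horizon n) (Suc n) (cost n) (dig (c + b ^ n * a))
      \<le> ave (Suc (horizon n)) n (cost n) (dig c)" if a: "a < b" for a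
  proof -
    have "good n c a \<longleftrightarrow> b * score n (c + b ^ n * a) \<le> (\<Sum>d<b. score n (c + b ^ n * d))"
      by (rule good_def)
    also have "\<dots> \<longleftrightarrow> real b * real (score n (c + b ^ n * a)) \<le> real (\<Sum>d<b. score n (c + b ^ n * d))"
      by (simp only: of_nat_mult[symmetric] of_nat_le_iff)
    also have "\<dots> \<longleftrightarrow> score n (c + b ^ n * a) / D \<le> real (\<Sum>d<b. score n (c + b ^ n * d)) / D / b"
      by (rule scale)
    finally show ?thesis unfolding score'[OF a] ave .
  qed
  obtain a where a: "a < b"
      "ave (horizon n) (Suc n) (cost n) ((dig c)(n := a)) \<le> ave (Suc (horizon n)) n (cost n) (dig c)"
    using exists_digit_le_ave by blast
  have "good n c a" unfolding iff[OF a(1)] using a(2) unfolding dig_upd[OF assms a(1)] .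
  then have *: "pick n c < b" "good n c (pick n c)"
    unfolding pick_def by (rule sum_before_first[OF a(1)])+
  show "pick n c < b" by (rule *(1))
  show "ave (horizon n) (Suc n) (cost n) (dig (c + b ^ n * pick n c))
      \<le> ave (Suc (horizon n)) n (cost n) (dig c)"
    using * iff by blast
qed

lemma code_Suc: "code (Suc n) = code n + b ^ n * greedy n"
  by (simp add: code_def greedy_def)

lemma code_less: "code n < b ^ n"
proof (induction n)
  case (Suc n)
  show ?case using append_less[OF Suc, of "greedy n" 1] pick(1)[OF Suc] by (simp add: code_Suc greedy_def)
qed (simp add: code_def)

lemma greedy_less: "greedy n < b"
  unfolding greedy_def by (rule pick(1)[OF code_less])

lemma dig_code: "t < n \<Longrightarrow> dig (code n) t = greedy t"
proof (induction n)
  case (Suc n)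
  have "dig (greedy n) 0 = greedy n" using greedy_less by (simp add: dig_def)
  then show ?case
    using Suc unfolding code_Suc dig_append[OF code_less] by (auto simp: less_Suc_eq)
qed simp

lemma greedy_poisson: "poisson_digits greedy"
proof (rule greedy_imp_poisson)
  fix n
  have "ave (horizon n) (Suc n) (cost n) greedy = ave (horizon n) (Suc n) (cost n) (dig (code (Suc n)))"
    by (rule ave_dep) (auto intro: dep_mono[OF dep_cost] simp: dig_code)
  also have "\<dots> \<le> ave (Suc (horizon n)) n (cost n) (dig (code n))"
    unfolding code_Suc greedy_def by (rule pick(2)[OF code_less])
  also have "\<dots> = ave (Suc (horizon n)) n (cost n) greedy"
    by (rule ave_dep) (auto intro: dep_mono[OF dep_cost] simp: dig_code)
  finally show "ave (horizon n) (Suc n) (cost n) greedy \<le> ave (Suc (horizon n)) n (cost n) greedy" .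
qed

end

section \<open>Recursiveness of the greedy sequence\<close>

context digits
begin

lemma recursive_word_hits: "recursive 4 (\<lambda>xs. word_hits (xs ! 0) (xs ! 1) (xs ! 2) (xs ! 3))"
  unfolding word_hits_def by (intro recursive_intros) simp_all

lemma recursive_freq_num: "recursive 4 (\<lambda>xs. freq_num (xs ! 0) (xs ! 1) (xs ! 2) (xs ! 3))"
  unfolding freq_num_def by (intro recursive_intros recursive_app4[OF recursive_word_hits]) simp_all

lemma recursive_mean_num: "recursive 4 (\<lambda>xs. mean_num (xs ! 0) (xs ! 1) (xs ! 2) (xs ! 3))"
  unfolding mean_num_def by (intro recursive_intros recursive_app4[OF recursive_freq_num]) simp_all

lemma recursive_sq_diff: "recursive 2 (\<lambda>xs. sq_diff (xs ! 0) (xs ! 1))"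
  unfolding sq_diff_def by (intro recursive_intros) simp_all

lemma recursive_grid: "recursive 2 (\<lambda>xs. grid (xs ! 0) (xs ! 1))"
  unfolding grid_def by (intro recursive_intros) simp_all

lemma recursive_dev_num: "recursive 3 (\<lambda>xs. dev_num (xs ! 0) (xs ! 1) (xs ! 2))"
  unfolding dev_num_def
  by (intro recursive_intros recursive_app2[OF recursive_sq_diff] recursive_app2[OF recursive_grid]
      recursive_app4[OF recursive_freq_num] recursive_app4[OF recursive_mean_num]) simp_all

lemma recursive_cost_num: "recursive 3 (\<lambda>xs. cost_num (xs ! 0) (xs ! 1) (xs ! 2))"
  unfolding cost_num_def by (intro recursive_intros recursive_app3[OF recursive_dev_num]) simp_all

lemma recursive_score: "recursive 2 (\<lambda>xs. score (xs ! 0) (xs ! 1))"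
  unfolding score_def horizon_def by (intro recursive_intros recursive_app3[OF recursive_cost_num]) simp_all

lemma recursive_pick: "recursive 2 (\<lambda>xs. pick (xs ! 0) (xs ! 1))"
  unfolding pick_def good_def by (intro recursive_intros recursive_app2[OF recursive_score]) simp_all

lemma recursive_greedy: "recursive 1 (\<lambda>xs. greedy (xs ! 0))"
  unfolding greedy_def code_def
  by (intro recursive_app2[OF recursive_pick] recursive_rec recursive_intros) simp_all

end

section \<open>Sequences over the alphabet\<close>

text \<open>Positions shift from \<open>0\<close>-based to \<open>1\<close>-based. The value at \<open>0\<close> is the one required by the
  extensional function space \<open>seqs\<close>.\<close>

definition spell :: "(nat \<Rightarrow> 'a) \<Rightarrow> (nat \<Rightarrow> nat) \<Rightarrow> nat \<Rightarrow> 'a" where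
  "spell e x j = (if j = 0 then undefined else e (x (j - 1)))"

lemma computable_spell:
  assumes e: "bij_betw e {..<card \<Omega>} \<Omega>" and x: "\<And>t. x t < card \<Omega>"
    and comp: "recursive 1 (\<lambda>xs. x (xs ! 0))"
  shows "computable_seq \<Omega> (spell e x)"
proof -
  have "recursive 1 (\<lambda>xs. (\<lambda>ys. x (ys ! 0)) (map (\<lambda>g. g xs) [\<lambda>xs. xs ! 0 - 1]))"
    using comp by (intro recursive_subst) (auto intro!: recursive_intros)
  then obtain p where p: "\<And>xs. length xs = 1 \<Longrightarrow> rec_eval p xs (x (xs ! 0 - 1))"
    unfolding recursive_def by auto
  let ?c = "inv_into {..<card \<Omega>} e"
  have "?c (spell e x n) = x (n - 1)" if "n \<ge> 1" for n
    using that x e by (simp add: spell_def bij_betw_inv_into_left)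
  then have "\<forall>n\<ge>1. rec_eval p [n] (?c (spell e x n))"
    using p[of "[_]"] by simp
  moreover have "bij_betw ?c \<Omega> {..<card \<Omega>}" using e by (rule bij_betw_inv_into)
  moreover have "spell e x \<in> {1..} \<rightarrow> \<Omega>"
    using bij_betwE[OF e] x by (auto simp: spell_def)
  ultimately have "computable_map \<Omega> (spell e x)" unfolding computable_map_def by blast
  then show ?thesis unfolding computable_seq_def by blast
qed

lemma spell_in_seqs:
  assumes "bij_betw e {..<card \<Omega>} \<Omega>" and "\<And>t. x t < card \<Omega>"
  shows "spell e x \<in> seqs \<Omega>"
  unfolding seqs_def using bij_betwE[OF assms(1)] assms(2)
  by (auto simp: PiE_iff extensional_def spell_def)

context digits
begin

lemma bij_betw_words:
  assumes e: "bij_betw e {..<b} \<Omega>"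
  shows "bij_betw (\<lambda>w. map (\<lambda>t. e (dig w t)) [0..<k]) {..<b ^ k} (words \<Omega> k)"
proof -
  let ?D = "\<lambda>w. map (\<lambda>t. e (dig w t)) [0..<k]"
  have inj: "inj_on ?D {..<b ^ k}"
  proof (rule inj_onI)
    fix v w assume vw: "v \<in> {..<b ^ k}" "w \<in> {..<b ^ k}" and eq: "?D v = ?D w"
    have "dig v t = dig w t" if "t < k" for t
    proof -
      have "e (dig v t) = e (dig w t)" using arg_cong[OF eq, of "\<lambda>l. l ! t"] that by simp
      then show ?thesis using e dig_less by (auto simp: bij_betw_def dest: inj_onD)
    qed
    then have "(\<Sum>t<k. dig v (0 + t) * b ^ t) = (\<Sum>t<k. dig w (0 + t) * b ^ t)" by simp
    then show "v = w" unfolding dig_eq_mod using vw by simp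
  qed
  have fin: "finite \<Omega>" "card \<Omega> = b" using e bij_betw_finite bij_betw_same_card by fastforce+
  have "?D ` {..<b ^ k} = words \<Omega> k"
  proof (rule card_subset_eq)
    show "?D ` {..<b ^ k} \<subseteq> words \<Omega> k"
      using bij_betwE[OF e] dig_less by (auto simp: words_def)
    show "finite (words \<Omega> k)" unfolding words_def by (rule finite_lists_length_eq[OF fin(1)])
    show "card (?D ` {..<b ^ k}) = card (words \<Omega> k)"
      unfolding card_image[OF inj] words_def card_lists_length_eq[OF fin(1)] by (simp add: fin(2))
  qed
  with inj show ?thesis by (simp add: bij_betw_def)
qed

lemma occ_spell:
  assumes e: "bij_betw e {..<b} \<Omega>" and x: "\<And>t. x t < b" and w: "w < b ^ k"
  shows "occ (spell e x) (map (\<lambda>t. e (dig w t)) [0..<k]) (Suc j) = of_bool (blk k x j = w)"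
proof -
  have "block (spell e x) (Suc j) k = map (\<lambda>t. e (x (j + t))) [0..<k]"
    unfolding block_def by (rule nth_equalityI) (auto simp: spell_def simp del: upt_Suc)
  moreover have "map (\<lambda>t. e (x (j + t))) [0..<k] = map (\<lambda>t. e (dig w t)) [0..<k]
      \<longleftrightarrow> (\<forall>t<k. x (j + t) = dig w t)"
    using e x dig_less by (auto simp: bij_betw_def inj_on_eq_iff)
  ultimately show ?thesis
    by (simp add: occ_def blk_eq_word_iff[OF x w])
qed

lemma Z_spell:
  assumes e: "bij_betw e {..<b} \<Omega>" and x: "\<And>t. x t < b"
  shows "Z \<Omega> lam i k (spell e x) = freq k (nat \<lfloor>lam * b ^ k\<rfloor>) i x"
proof -
  let ?D = "\<lambda>w. map (\<lambda>t. e (dig w t)) [0..<k]" and ?T = "nat \<lfloor>lam * b ^ k\<rfloor>"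
  let ?N = "\<lambda>w. \<Sum>j | 1 \<le> j \<and> real j \<le> lam * real (b ^ k). occ (spell e x) w j"
  have b: "card \<Omega> = b" using bij_betw_same_card[OF e] by simp
  have "1 \<le> j \<and> real j \<le> r \<longleftrightarrow> Suc 0 \<le> j \<and> j \<le> nat \<lfloor>r\<rfloor>" for j and r :: real
    by linarith
  then have "{j. 1 \<le> j \<and> real j \<le> lam * real (b ^ k)} = {Suc 0..?T}"
    by (simp only: atLeastAtMost_def atLeast_def atMost_def Int_def mem_Collect_eq)
  then have N: "?N (?D w) = hits k ?T x w" if "w < b ^ k" for w
    unfolding hits_def by (simp add: sum.atLeast1_atMost_eq occ_spell[OF e x that] del: of_nat_power)
  have "{w \<in> words \<Omega> k. ?N w = i} = ?D ` {w \<in> {..<b ^ k}. hits k ?T x w = i}"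
  proof -
    have "{w \<in> ?D ` A. P w} = ?D ` {w \<in> A. Q w}" if "\<And>w. w \<in> A \<Longrightarrow> P (?D w) = Q w" for A P Q
      using that by blast
    from this[of "{..<b ^ k}" "\<lambda>w. ?N w = i" "\<lambda>w. hits k ?T x w = i"] N
    show ?thesis unfolding bij_betw_imp_surj_on[OF bij_betw_words[OF e, of k]] by simp
  qed
  moreover have "inj_on ?D {w \<in> {..<b ^ k}. hits k ?T x w = i}"
    using bij_betw_imp_inj_on[OF bij_betw_words[OF e, of k]] by (rule inj_on_subset) auto
  ultimately have "card {w \<in> words \<Omega> k. ?N w = i} = card {w \<in> {..<b ^ k}. hits k ?T x w = i}"
    by (simp only: card_image)
  also have "{w \<in> {..<b ^ k}. hits k ?T x w = i} = {..<b ^ k} \<inter> {w. hits k ?T x w = i}" by auto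
  finally show ?thesis
    unfolding Z_def freq_def b by (simp add: Groups_Big.sum_of_bool_eq)
qed

lemma poisson_generic_spell:
  assumes "bij_betw e {..<b} \<Omega>" and "\<And>t. x t < b" and "poisson_digits x"
  shows "poisson_generic \<Omega> (spell e x)"
  using assms(3)
  by (simp add: poisson_generic_def poisson_generic_at_def poisson_digits_def Z_spell[OF assms(1,2)])

end

instance recf :: countable
  by countable_datatype

text \<open>A computable sequence is determined by a program and by the decoding of its values into symbols;
  there are countably many programs and finitely many decodings.\<close>

lemma countable_computable_seqs:
  assumes "finite \<Omega>"
  shows "countable {x \<in> seqs \<Omega>. computable_seq \<Omega> x}"
proof (rule countable_subset)
  \<comment> \<open>Extensional functions, so that the decodings form a finite set.\<close>
  let ?D = "{..<card \<Omega>} \<rightarrow>\<^sub>E \<Omega>"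
  define g where "g = (\<lambda>(p, d) n. if n = 0 then undefined else d (THE y. rec_eval p [n] y) :: 'a)"
  show "{x \<in> seqs \<Omega>. computable_seq \<Omega> x} \<subseteq> g ` (UNIV \<times> ?D)"
  proof safe
    fix x assume x: "x \<in> seqs \<Omega>" "computable_seq \<Omega> x"
    then obtain f c p where f: "\<And>n. n \<ge> 1 \<Longrightarrow> f n = x n" "f \<in> {1..} \<rightarrow> \<Omega>"
      and c: "bij_betw c \<Omega> {..<card \<Omega>}" and p: "\<And>n. n \<ge> 1 \<Longrightarrow> rec_eval p [n] (c (f n))"
      unfolding computable_seq_def computable_map_def by blast
    let ?d = "restrict (inv_into \<Omega> c) {..<card \<Omega>}"
    have "x n = g (p, ?d) n" for n
    proof (cases "n = 0")
      case True
      then show ?thesis using x(1) by (auto simp: seqs_def g_def PiE_def extensional_def)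
    next
      case False
      then have n: "n \<ge> 1" by simp
      have "(THE y. rec_eval p [n] y) = c (f n)"
        using p[OF n] rec_eval_unique by (intro the_equality) auto
      moreover have "f n \<in> \<Omega>" using f(2) n by auto
      ultimately show ?thesis
        using False f(1)[OF n] c bij_betwE[OF c]
        by (simp add: g_def bij_betw_inv_into_left)
    qed
    moreover have "?d \<in> ?D"
      using bij_betwE[OF bij_betw_inv_into[OF c]] by auto
    ultimately show "x \<in> g ` (UNIV \<times> ?D)" by (intro image_eqI[of _ _ "(p, ?d)"]) auto
  qed
  have "finite ?D" using assms by (intro finite_PiE) auto
  then show "countable (g ` (UNIV \<times> ?D))"
    by (rule countable_image[OF countable_SIGMA[OF countableI_type countable_finite]])
qed

theorem theorem2:
  fixes \<Omega> :: "'a set"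
  assumes "finite \<Omega>" and "card \<Omega> \<ge> 2"
  shows "countable {x \<in> seqs \<Omega>. computable_seq \<Omega> x \<and> poisson_generic \<Omega> x} \<and>
         infinite {x \<in> seqs \<Omega>. computable_seq \<Omega> x \<and> poisson_generic \<Omega> x}"
proof
  show "countable {x \<in> seqs \<Omega>. computable_seq \<Omega> x \<and> poisson_generic \<Omega> x}"
    by (rule countable_subset[OF _ countable_computable_seqs[OF assms(1)]]) auto
  interpret digits "card \<Omega>" by unfold_locales (rule assms(2))
  obtain e where "bij_betw e {0..<card \<Omega>} \<Omega>"
    using ex_bij_betw_nat_finite[OF assms(1)] by blast
  then have e: "bij_betw e {..<card \<Omega>} \<Omega>" by (simp add: atLeast0LessThan)
  \<comment> \<open>The sequences \<open>y N\<close> differ from the greedy sequence exactly at \<open>N\<close>, hence from each other.\<close>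
  define y where "y N = greedy(N := (if greedy N = 0 then 1 else 0))" for N
  have less: "y N t < card \<Omega>" for N t
    using greedy_less b_ge_2 by (simp add: y_def)
  have mem: "spell e (y N) \<in> {x \<in> seqs \<Omega>. computable_seq \<Omega> x \<and> poisson_generic \<Omega> x}" for N
  proof (intro CollectI conjI)
    show "spell e (y N) \<in> seqs \<Omega>" by (rule spell_in_seqs[OF e less])
    show "computable_seq \<Omega> (spell e (y N))"
      by (rule computable_spell[OF e less]) (unfold y_def, rule recursive_fun_upd[OF recursive_greedy])
    show "poisson_generic \<Omega> (spell e (y N))"
      by (rule poisson_generic_spell[OF e less]) (unfold y_def, rule poisson_digits_upd[OF greedy_poisson])
  qed
  have "inj (\<lambda>N. spell e (y N))"
  proof (rule injI, rule ccontr)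
    fix M N assume eq: "spell e (y M) = spell e (y N)" and "M \<noteq> N"
    have "e (y M N) = e (y N N)" using fun_cong[OF eq, of "Suc N"] by (simp add: spell_def)
    then have "y M N = y N N" using e less by (auto simp: bij_betw_def dest: inj_onD)
    then show False using \<open>M \<noteq> N\<close> by (simp add: y_def split: if_splits)
  qed
  then have "infinite (range (\<lambda>N. spell e (y N)))" by (rule range_inj_infinite)
  then show "infinite {x \<in> seqs \<Omega>. computable_seq \<Omega> x \<and> poisson_generic \<Omega> x}"
    by (rule infinite_super[rotated]) (use mem in blast)
qed

end
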